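(* Let $G$ be a finite abelian group, let $H$ be a subgroup of $G$, and let $n$ be an integer with $n\ge [G:H]$. Let $a_0\ge a_1\ge\cdots\ge a_{n-1}>0$ be real numbers. Denote by $m_0$ the smallest index $m$ with $0\le m\le [G:H]-1$ such that $$([G:H]-m)\,a_m^2\le\sum_{j=m}^{n-1}a_j^2 .$$ Let $f_0,\dots,f_{n-1}\in\ell(G)$, and suppose that the convolutional system $X_H(\{f_m\}_{m=0}^{n-1})$ is a local minimizer of the frame potential under the constraint $\|f_m\|=a_m$ for $0\le m\le n-1$. Then $X_H(\{f_m\}_{m=0}^{n-1})$ may be divided into two mutually orthogonal subcollections of $\ell(G)$, namely: (1) $X_H(\{f_m\}_{m=0}^{m_0-1})$, which consists of mutually orthogonal, nonzero vectors; and (2) $X_H(\{f_m\}_{m=m_0}^{n-1})$, which is a tight frame for its $|H|([G:H]-m_0)$-dimensional span. In particular, if $m_0=0$, then $X_H(\{f_m\}_{m=0}^{n-1})$ is a tight frame for $\ell(G)$.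
   Context: $G$ is written multiplicatively. $\ell(G)$ denotes the (real or complex) Hilbert space of all scalar-valued functions on $G$, with inner product $\langle f_1,f_2\rangle=\sum_{g\in G}f_1(g)\overline{f_2(g)}$ and norm $\|f\|=\langle f,f\rangle^{1/2}$. For $g\in G$, the translation operator $T_g:\ell(G)\to\ell(G)$ is $(T_gf)(g')=f(g'g^{-1})$. For a subgroup $H\le G$ and a family $\{f_m\}_{m\in I}\subset\ell(G)$ with finite index set $I$, the convolutional system generated by $\{f_m\}_{m\in I}$ with sampling over $H$ is the collection $X_H(\{f_m\}_{m\in I})=\{T_hf_m: h\in H,\ m\in I\}$, regarded as a family indexed by $H\times I$ (repetitions are counted). It is empty if $I$ is empty. The frame potential of a finite family $X=\{x_k\}_{k=1}^{N}$ in a finite-dimensional Hilbert space is $\mathrm{FP}(X)=\sum_{j=1}^{N}\sum_{k=1}^{N}|\langle x_j,x_k\rangle|^2$. That $X_H(\{f_m\}_{m=0}^{n-1})$ is a local minimizer of the frame potential under the constraint $\|f_m\|=a_m$ means that $(f_0,\dots,f_{n-1})$ is a local minimizer of the function $(u_0,\dots,u_{n-1})\mapsto \mathrm{FP}(X_H(\{u_m\}_{m=0}^{n-1}))$ on the set of tuples $(u_0,\dots,u_{n-1})\in\ell(G)^n$ with $\|u_m\|=a_m$ for $0\le m\le n-1$. A finite family $\{x_k\}_{k=1}^{N}$ of vectors in a finite-dimensional Hilbert space $V$ is a tight frame for $V$ if there is a real $A>0$ such that $\sum_{k=1}^{N}|\langle x,x_k\rangle|^2=A\|x\|^2$ for all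 $x\in V$. Two subcollections are mutually orthogonal if every vector of one is orthogonal to every vector of the other. *)

theory Defs
  imports Complex_Main "HOL-Algebra.Coset" "HOL-Library.Function_Algebras"
begin

text \<open>
  The scalars are real or complex. To treat both cases at once we use a type class of real normed
  fields with a conjugation; \<open>real_or_complex_cases\<close> below shows that its models are exactly
  the real and the complex numbers, up to isomorphism.
\<close>

class real_or_complex = real_normed_field +
  fixes conjugate :: "'a \<Rightarrow> 'a"
  assumes conjugate_add: "conjugate (x + y) = conjugate x + conjugate y"
    and mult_conjugate_scaleR: "x * conjugate x = (norm x)\<^sup>2 *\<^sub>R 1"

instantiation real :: real_or_complex
begin
definition conjugate_real :: "real \<Rightarrow> real" where "conjugate_real x = x"
instance
  by standard (simp_all add: conjugate_real_def power2_eq_square)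
end

instantiation complex :: real_or_complex
begin
definition conjugate_complex :: "complex \<Rightarrow> complex" where "conjugate_complex = cnj"
instance
proof
  fix x y :: complex
  show "conjugate (x + y) = conjugate x + conjugate y"
    by (simp add: conjugate_complex_def)
  show "x * conjugate x = (norm x)\<^sup>2 *\<^sub>R 1"
    by (simp only: conjugate_complex_def scaleR_conv_of_real complex_norm_square mult_1_right)
qed
end

lemma mult_conjugate:
  fixes x :: "'k::real_or_complex"
  shows "x * conjugate x = of_real ((norm x)\<^sup>2)"
  by (simp only: mult_conjugate_scaleR of_real_def)

lemma conjugate_eq:
  fixes x :: "'k::real_or_complex"
  assumes "x \<noteq> 0"
  shows "conjugate x = of_real ((norm x)\<^sup>2) / x"
  using mult_conjugate[of x] assms by (simp add: field_simps)

lemma conjugate_0: "conjugate 0 = (0 :: 'k::real_or_complex)"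
  using conjugate_add[of "0::'k" 0] by simp

lemma conjugate_mult:
  fixes x y :: "'k::real_or_complex"
  shows "conjugate (x * y) = conjugate x * conjugate y"
  by (cases "x = 0"; cases "y = 0")
    (simp_all add: conjugate_0 conjugate_eq norm_mult power_mult_distrib)

lemma conjugate_of_real: "conjugate (of_real r) = (of_real r :: 'k::real_or_complex)"
proof (cases "r = 0")
  case False
  have "conjugate (of_real r) = (of_real (r\<^sup>2 / r) :: 'k)"
    using False by (simp only: conjugate_eq of_real_eq_0_iff norm_of_real power2_abs of_real_divide
        not_False_eq_True)
  then show ?thesis
    by (simp add: power2_eq_square)
qed (simp add: conjugate_0)

lemma conjugate_minus: "conjugate (- x) = - conjugate (x :: 'k::real_or_complex)"
  using conjugate_add[of x "- x"] by (simp add: conjugate_0 eq_neg_iff_add_eq_0 add.commute)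

lemma conjugate_diff: "conjugate (x - y) = conjugate x - conjugate (y :: 'k::real_or_complex)"
  using conjugate_add[of x "- y"] by (simp add: conjugate_minus)

lemma add_conjugate_in_Reals: "x + conjugate x \<in> (\<real> :: 'k::real_or_complex set)"
proof -
  have c1: "conjugate 1 = (1::'k)"
    using conjugate_of_real[of 1, where ?'k = 'k] by simp
  have "(x + 1) * (conjugate x + 1) = of_real ((norm (x + 1))\<^sup>2)"
    using mult_conjugate[of "x + 1"] by (simp add: conjugate_add c1)
  then have "x + conjugate x = of_real ((norm (x + 1))\<^sup>2 - (norm x)\<^sup>2 - 1)"
    using mult_conjugate[of x] by (simp add: algebra_simps)
  then show ?thesis
    by (metis Reals_of_real)
qed

theorem real_or_complex_cases:
  "\<exists>\<phi> :: 'k::real_or_complex \<Rightarrow> complex.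
     (\<forall>x y. \<phi> (x + y) = \<phi> x + \<phi> y) \<and> (\<forall>x y. \<phi> (x * y) = \<phi> x * \<phi> y) \<and>
     (\<forall>r. \<phi> (of_real r) = of_real r) \<and> (\<forall>x. norm (\<phi> x) = norm x) \<and>
     (\<forall>x. \<phi> (conjugate x) = cnj (\<phi> x)) \<and> inj \<phi> \<and> (range \<phi> = \<real> \<or> range \<phi> = UNIV)"
proof (cases "(UNIV :: 'k set) = \<real>")
  case True
  then have "\<forall>x::'k. \<exists>r. x = of_real r"
    by (metis Reals_cases UNIV_I)
  then obtain \<rho> :: "'k \<Rightarrow> real" where \<rho>: "\<And>x. x = of_real (\<rho> x)"
    by metis
  have r: "\<rho> (of_real r) = r" for r
    using \<rho>[of "of_real r"] by (simp only: of_real_eq_iff)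
  have "\<rho> (x + y) = \<rho> x + \<rho> y" for x y
    by (metis \<rho> r of_real_add)
  moreover have "\<rho> (x * y) = \<rho> x * \<rho> y" for x y
    by (metis \<rho> r of_real_mult)
  moreover have "\<bar>\<rho> x\<bar> = norm x" for x
    by (metis \<rho> norm_of_real)
  moreover have "\<rho> (conjugate x) = \<rho> x" for x
    by (metis \<rho> conjugate_of_real)
  moreover have "inj \<rho>"
    by (metis \<rho> injI)
  moreover have "range (\<lambda>x. complex_of_real (\<rho> x)) = \<real>"
    unfolding Reals_def by (metis r image_image surj_def)
  ultimately show ?thesis
    using r by (intro exI[of _ "\<lambda>x. of_real (\<rho> x)"]) (auto simp: inj_def)
next
  case False
  then obtain x :: 'k where x: "x \<notin> \<real>"
    by blast
  obtain r where r: "x + conjugate x = of_real r"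
    using add_conjugate_in_Reals Reals_cases by metis
  define y where "y = x - of_real (r / 2)"
  have y0: "y \<noteq> 0"
    using x unfolding y_def by (metis Reals_of_real eq_iff_diff_eq_0)
  have cy: "conjugate y = - y"
  proof -
    have "conjugate y + y = x + conjugate x - (of_real (r/2) + of_real (r/2))"
      unfolding y_def by (simp only: conjugate_diff conjugate_of_real) (simp add: algebra_simps)
    also have "\<dots> = 0"
      by (simp only: r flip: of_real_add) simp
    finally show ?thesis
      by (simp add: eq_neg_iff_add_eq_0)
  qed
  define i where "i = y / of_real (norm y)"
  have sq: "w * w = - of_real ((norm w)\<^sup>2)" if "conjugate w = - w" for w :: 'k
    using mult_conjugate[of w] that by (metis minus_mult_right minus_minus)
  have ii: "i * i = -1"
    using y0 sq[OF cy] unfolding i_def by (simp add: power2_eq_square)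
  have ci: "conjugate i = - i"
  proof -
    have "i = of_real (inverse (norm y)) * y"
      unfolding i_def by (simp add: field_simps)
    then show ?thesis
      by (simp add: conjugate_mult cy conjugate_of_real del: of_real_inverse)
  qed
  define \<psi> :: "complex \<Rightarrow> 'k" where "\<psi> z = of_real (Re z) + of_real (Im z) * i" for z
  have add: "\<psi> (z + w) = \<psi> z + \<psi> w" for z w
    unfolding \<psi>_def by (simp add: algebra_simps)
  have mult: "\<psi> (z * w) = \<psi> z * \<psi> w" for z w
  proof -
    have "\<psi> z * \<psi> w = of_real (Re z * Re w) + of_real (Im z * Im w) * (i * i)
        + of_real (Re z * Im w + Im z * Re w) * i"
      unfolding \<psi>_def by (simp add: algebra_simps)
    then show ?thesis
      unfolding \<psi>_def ii by simp
  qed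
  have re: "\<psi> (of_real s) = of_real s" for s
    unfolding \<psi>_def by simp
  have cj: "conjugate (\<psi> z) = \<psi> (cnj z)" for z
    unfolding \<psi>_def by (simp add: conjugate_add conjugate_mult conjugate_of_real ci)
  have nm: "norm (\<psi> z) = norm z" for z
  proof -
    have "of_real ((norm (\<psi> z))\<^sup>2) = \<psi> (z * cnj z)"
      using mult_conjugate[of "\<psi> z"] by (simp add: cj mult)
    also have "\<dots> = of_real ((norm z)\<^sup>2)"
      by (metis complex_norm_square re)
    finally have "(norm (\<psi> z))\<^sup>2 = (norm z)\<^sup>2"
      by (simp only: of_real_eq_iff)
    then show ?thesis
      by simp
  qed
  have inj: "inj \<psi>"
  proof (rule injI)
    fix z w assume "\<psi> z = \<psi> w"
    moreover have "\<psi> (z - w) + \<psi> w = \<psi> z"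
      by (simp flip: add)
    ultimately have "\<psi> (z - w) = 0"
      by simp
    then show "z = w"
      using nm[of "z - w"] by simp
  qed
  have surj: "\<exists>z. v = \<psi> z" for v
  proof -
    obtain s where s: "v + conjugate v = of_real s"
      using add_conjugate_in_Reals Reals_cases by metis
    define w where "w = v - of_real (s / 2)"
    have "conjugate w + w = v + conjugate v - (of_real (s/2) + of_real (s/2))"
      unfolding w_def by (simp only: conjugate_diff conjugate_of_real) (simp add: algebra_simps)
    also have "\<dots> = 0"
      by (simp only: s flip: of_real_add) simp
    finally have "conjugate w = - w"
      by (simp add: eq_neg_iff_add_eq_0)
    then have "w * w - of_real (norm w) * of_real (norm w) * (i * i) = 0"
      using sq[of w] by (simp add: ii power2_eq_square)
    then have "(w - of_real (norm w) * i) * (w + of_real (norm w) * i) = 0"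
      by (simp add: algebra_simps)
    then have "w = of_real (norm w) * i \<or> w = of_real (- norm w) * i"
      by (simp add: eq_neg_iff_add_eq_0)
    then obtain t where "w = of_real t * i"
      by blast
    then have "v = \<psi> (Complex (s / 2) t)"
      unfolding \<psi>_def w_def by (simp add: algebra_simps)
    then show ?thesis ..
  qed
  define \<phi> where "\<phi> = inv_into UNIV \<psi>"
  have pf: "\<psi> (\<phi> v) = v" for v
    unfolding \<phi>_def using surj by (metis surj_def surj_f_inv_f)
  have fp: "\<phi> (\<psi> z) = z" for z
    unfolding \<phi>_def using inj by simp
  have \<phi>_add: "\<phi> (x + y) = \<phi> x + \<phi> y" for x y
    using fp[of "\<phi> x + \<phi> y"] by (simp add: add pf)
  have \<phi>_mult: "\<phi> (x * y) = \<phi> x * \<phi> y" for x y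
    using fp[of "\<phi> x * \<phi> y"] by (simp add: mult pf)
  have \<phi>_re: "\<phi> (of_real s) = of_real s" for s
    using fp[of "of_real s"] by (simp add: re)
  have \<phi>_nm: "norm (\<phi> x) = norm x" for x
    using nm[of "\<phi> x"] by (simp add: pf)
  have \<phi>_cj: "\<phi> (conjugate x) = cnj (\<phi> x)" for x
    using fp[of "cnj (\<phi> x)"] cj[of "\<phi> x"] by (simp add: pf)
  have "range \<phi> = UNIV"
    by (metis fp surj_def)
  moreover have "inj \<phi>"
    by (metis pf injI)
  ultimately show ?thesis
    by (intro exI[of _ \<phi>] conjI allI) (simp_all add: \<phi>_add \<phi>_mult \<phi>_re \<phi>_nm \<phi>_cj)
qed

text \<open>
  \<open>\<ell>(G)\<close>: a function on the carrier is represented by its extension by zero to the whole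
  type, so that \<open>\<ell>(G)\<close> is a linear subspace of \<open>'a \<Rightarrow> 'k\<close> (with pointwise operations).
\<close>

definition ell :: "('a, 'b) monoid_scheme \<Rightarrow> ('a \<Rightarrow> 'k::real_or_complex) set" where
  "ell G = {f. \<forall>g. g \<notin> carrier G \<longrightarrow> f g = 0}"

global_interpretation fun_space: vector_space "\<lambda>(c::'k::field) (f::'a \<Rightarrow> 'k) g. c * f g"
  by standard (simp_all add: fun_eq_iff algebra_simps)

definition ell_inner ::
    "('a, 'b) monoid_scheme \<Rightarrow> ('a \<Rightarrow> 'k::real_or_complex) \<Rightarrow> ('a \<Rightarrow> 'k) \<Rightarrow> 'k" where
  "ell_inner G f1 f2 = (\<Sum>g\<in>carrier G. f1 g * conjugate (f2 g))"

text \<open>The inner scalar norm only turns the nonnegative scalar \<open>\<langle>f, f\<rangle>\<close> into a real number.\<close>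

definition ell_norm ::
    "('a, 'b) monoid_scheme \<Rightarrow> ('a \<Rightarrow> 'k::real_or_complex) \<Rightarrow> real" where
  "ell_norm G f = sqrt (norm (ell_inner G f f))"

definition translation ::
    "('a, 'b) monoid_scheme \<Rightarrow> 'a \<Rightarrow> ('a \<Rightarrow> 'k::real_or_complex) \<Rightarrow> 'a \<Rightarrow> 'k" where
  "translation G g f = (\<lambda>g'. if g' \<in> carrier G then f (g' \<otimes>\<^bsub>G\<^esub> inv\<^bsub>G\<^esub> g) else 0)"

text \<open>
  A family of vectors is an index set together with a function on indices, so that repetitions
  count. The convolutional system \<open>X\<^sub>H({f\<^sub>m}\<^sub>m\<^sub>\<in>\<^sub>I)\<close> is the function
  \<open>conv_system G f\<close> on the index set \<open>H \<times> I\<close>.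
\<close>

definition conv_system ::
    "('a, 'b) monoid_scheme \<Rightarrow> ('i \<Rightarrow> 'a \<Rightarrow> 'k::real_or_complex) \<Rightarrow> 'a \<times> 'i \<Rightarrow> 'a \<Rightarrow> 'k" where
  "conv_system G f = (\<lambda>(h, m). translation G h (f m))"

definition frame_potential ::
    "('a, 'b) monoid_scheme \<Rightarrow> 'j set \<Rightarrow> ('j \<Rightarrow> 'a \<Rightarrow> 'k::real_or_complex) \<Rightarrow> real" where
  "frame_potential G J x = (\<Sum>j\<in>J. \<Sum>k\<in>J. (norm (ell_inner G (x j) (x k)))\<^sup>2)"

text \<open>
  An \<open>n\<close>-tuple in \<open>\<ell>(G)\<close> is a function on \<open>nat\<close> of which only the values at
  \<open>m < n\<close> matter. The neighbourhoods in the second definition are those of the product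
  topology on \<open>\<ell>(G)\<^sup>n\<close>.
\<close>

definition norm_constraint_set ::
    "('a, 'b) monoid_scheme \<Rightarrow> nat \<Rightarrow> (nat \<Rightarrow> real) \<Rightarrow> (nat \<Rightarrow> 'a \<Rightarrow> 'k::real_or_complex) set" where
  "norm_constraint_set G n a = {u. \<forall>m<n. u m \<in> ell G \<and> ell_norm G (u m) = a m}"

definition local_minimizer_FP ::
    "('a, 'b) monoid_scheme \<Rightarrow> 'a set \<Rightarrow> nat \<Rightarrow> (nat \<Rightarrow> real) \<Rightarrow>
      (nat \<Rightarrow> 'a \<Rightarrow> 'k::real_or_complex) \<Rightarrow> bool" where
  "local_minimizer_FP G H n a f \<longleftrightarrow>
     f \<in> norm_constraint_set G n a \<and>
     (\<exists>\<epsilon>>0. \<forall>u\<in>norm_constraint_set G n a. (\<forall>m<n. ell_norm G (u m - f m) < \<epsilon>) \<longrightarrow>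
        frame_potential G (H \<times> {..<n}) (conv_system G f)
          \<le> frame_potential G (H \<times> {..<n}) (conv_system G u))"

definition tight_frame ::
    "('a, 'b) monoid_scheme \<Rightarrow> ('a \<Rightarrow> 'k::real_or_complex) set \<Rightarrow> 'j set \<Rightarrow>
      ('j \<Rightarrow> 'a \<Rightarrow> 'k) \<Rightarrow> bool" where
  "tight_frame G V J x \<longleftrightarrow>
     finite J \<and> (\<forall>j\<in>J. x j \<in> V) \<and>
     (\<exists>A>0. \<forall>v\<in>V. (\<Sum>j\<in>J. (norm (ell_inner G v (x j)))\<^sup>2) = A * (ell_norm G v)\<^sup>2)"

end

theory Submission
  imports Defs
begin

text \<open>
Let \<open>S\<close> be the frame operator of the system. It is self-adjoint and commutes with translations by
\<open>H\<close>, hence with convolution by the functions supported on \<open>H\<close>. These functions form a commutative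
algebra with involution, over which \<open>\<ell>(G)\<close> is free of rank \<open>d = [G:H]\<close>. The frame potential is the
squared Hilbert--Schmidt norm of \<open>S\<close>, and two perturbations of it carry the proof.

The first variation shows that every generator is an eigenvector, \<open>S f\<^sub>m = \<lambda>\<^sub>m f\<^sub>m\<close> (\<open>S_f\<close>). For
the second, let \<open>S e = \<mu> e\<close>, and let \<open>b\<^sub>m\<close>, for the \<open>m\<close> with \<open>\<lambda>\<^sub>m > \<mu>\<close>, be functions on \<open>H\<close>
with \<open>\<Sum> b\<^sub>m * f\<^sub>m = 0\<close>. Moving each \<open>f\<^sub>m\<close> in the direction \<open>b\<^sub>m\<^sup>* * e\<close> changes \<open>S\<close> only to second
order, because the relation makes the mixed terms cancel, and it changes the frame potential by a positive multiple of
\<open>\<Sum> (\<mu> - \<lambda>\<^sub>m) \<parallel>b\<^sub>m\<^sup>* * e\<parallel>\<^sup>2\<close> to leading order. Minimality forces \<open>b\<^sub>m\<^sup>* * e = 0\<close>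
(\<open>annihilation_from_relation\<close>). So relations between generators of large eigenvalue annihilate every
eigenvector of smaller eigenvalue.

The rest is counting of dimensions over the algebra. If \<open>\<mu>\<close> is an eigenvalue of \<open>S\<close>, fewer than \<open>d\<close>
generators have a larger eigenvalue: otherwise an ideal attached to an eigenvector \<open>e\<close> has too little room, and one
obtains a relation that does not annihilate \<open>e\<close> (\<open>card_generators_less\<close>). If \<open>0\<close> were an
eigenvalue, this would contradict \<open>n \<ge> d\<close>, as all \<open>\<lambda>\<^sub>m\<close> are positive; hence the system spans \<open>\<ell>(G)\<close>. Now let \<open>\<mu>\<close> be the least
\<open>\<lambda>\<^sub>m\<close>, and call \<open>m\<close> dominant if \<open>\<lambda>\<^sub>m > \<mu>\<close>. Fewer than \<open>d\<close> generators cannot generate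
\<open>b * \<ell>(G)\<close> for any \<open>b \<noteq> 0\<close>, so no \<open>b \<noteq> 0\<close> annihilates the \<open>\<mu>\<close>-eigenspace
(\<open>annihilator_of_corank_eq_0\<close>). Combined with the second variation, this says that the dominant generators satisfy no
relation at all. Being eigenvectors of \<open>S\<close>, they then have pairwise orthogonal translates, and
\<open>\<lambda>\<^sub>m = a\<^sub>m\<^sup>2\<close> for them, while the other generators form a tight frame, with bound \<open>\<mu>\<close>, for the
orthogonal complement. Taking the trace of \<open>S\<close> computes \<open>\<mu>\<close> from the norms and identifies the number of dominant
generators with the index \<open>m\<^sub>0\<close> (\<open>threshold_index\<close>).

For complex scalars, the Fourier transform over the dual group of \<open>H\<close> splits the algebra into copies of the scalar field,
and each count becomes linear algebra in dimension \<open>d\<close> at a single character. Working with ideals of the algebra instead treats real and complex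
scalars at the same time.
\<close>

section \<open>Scalars\<close>

lemma norm_conjugate [simp]: "norm (conjugate x) = norm (x :: 'k::real_or_complex)"
proof (cases "x = 0")
  case False
  have "norm x * norm (conjugate x) = (norm x)\<^sup>2"
    by (metis mult_conjugate norm_mult norm_of_real abs_power2 power2_abs)
  then show ?thesis
    using False by (simp add: power2_eq_square)
qed (simp add: conjugate_0)

lemma conjugate_eq_0_iff [simp]: "conjugate x = 0 \<longleftrightarrow> x = (0 :: 'k::real_or_complex)"
  by (metis norm_conjugate norm_eq_zero)

lemma conjugate_conjugate [simp]: "conjugate (conjugate x) = (x :: 'k::real_or_complex)"
proof (cases "x = 0")
  case False
  have "x * conjugate x = conjugate (conjugate x) * conjugate x"
    using mult_conjugate[of x] mult_conjugate[of "conjugate x"] by (simp add: mult.commute)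
  then show ?thesis
    using False by simp
qed (simp add: conjugate_0)

lemma conjugate_sum: "conjugate (\<Sum>i\<in>I. x i) = (\<Sum>i\<in>I. conjugate (x i) :: 'k::real_or_complex)"
  by (induction I rule: infinite_finite_induct) (simp_all add: conjugate_0 conjugate_add)

lemma tendsto_conjugate [tendsto_intros]:
  fixes x :: "'i \<Rightarrow> 'k::real_or_complex"
  assumes "(x \<longlongrightarrow> l) F"
  shows "((\<lambda>t. conjugate (x t)) \<longlongrightarrow> conjugate l) F"
proof -
  have "((\<lambda>t. norm (conjugate (x t - l))) \<longlongrightarrow> 0) F"
    using assms by (simp add: LIM_zero tendsto_norm_zero)
  then show ?thesis
    unfolding conjugate_diff by (simp add: tendsto_norm_zero_iff LIM_zero_iff)
qed

section \<open>The inner product\<close>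

lemma sum_fun_apply: "(\<Sum>i\<in>I. x i) g = (\<Sum>i\<in>I. x i g :: 'k::comm_monoid_add)"
  by (induction I rule: infinite_finite_induct) simp_all

lemma ell_inner_sum_left:
  "ell_inner G (\<lambda>g. \<Sum>i\<in>I. c i * u i g) v = (\<Sum>i\<in>I. c i * ell_inner G (u i) v)"
  unfolding ell_inner_def
  by (simp add: sum_distrib_left sum_distrib_right mult.assoc) (rule sum.swap)

lemma ell_inner_commute: "ell_inner G v u = conjugate (ell_inner G u v)"
  unfolding ell_inner_def by (simp add: conjugate_sum conjugate_mult mult.commute)

lemma ell_inner_sum_right:
  "ell_inner G v (\<lambda>g. \<Sum>i\<in>I. c i * u i g) = (\<Sum>i\<in>I. conjugate (c i) * ell_inner G v (u i))"
  by (subst ell_inner_commute)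
    (simp add: ell_inner_sum_left conjugate_sum conjugate_mult flip: ell_inner_commute)

lemma ell_inner_lin_left:
  "ell_inner G (\<lambda>g. c * u g) v = c * ell_inner G u v"
  "ell_inner G (\<lambda>g. u g + w g) v = ell_inner G u v + ell_inner G w v"
  "ell_inner G (\<lambda>g. u g - w g) v = ell_inner G u v - ell_inner G w v"
  "ell_inner G (\<lambda>g. 0) v = 0" "ell_inner G 0 v = 0"
  "ell_inner G (u + w) v = ell_inner G u v + ell_inner G w v"
  unfolding ell_inner_def
  by (simp_all add: algebra_simps sum_distrib_left sum.distrib sum_subtractf)

lemma ell_inner_lin_right:
  "ell_inner G v (\<lambda>g. c * u g) = conjugate c * ell_inner G v u"
  "ell_inner G v (\<lambda>g. u g + w g) = ell_inner G v u + ell_inner G v w"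
  "ell_inner G v (\<lambda>g. u g - w g) = ell_inner G v u - ell_inner G v w"
  "ell_inner G v (\<lambda>g. 0) = 0" "ell_inner G v 0 = 0"
  "ell_inner G v (u + w) = ell_inner G v u + ell_inner G v w"
  unfolding ell_inner_def
  by (simp_all add: algebra_simps sum_distrib_left sum.distrib sum_subtractf
      conjugate_0 conjugate_add conjugate_mult conjugate_diff)

lemma ell_inner_self: "ell_inner G u u = of_real (\<Sum>g\<in>carrier G. (norm (u g))\<^sup>2)"
  unfolding ell_inner_def by (simp add: mult_conjugate)

lemma ell_norm_sq: "(ell_norm G u)\<^sup>2 = (\<Sum>g\<in>carrier G. (norm (u g))\<^sup>2)"
  unfolding ell_norm_def ell_inner_self norm_of_real by (simp add: sum_nonneg)

lemma ell_inner_self_norm: "ell_inner G u u = of_real ((ell_norm G u)\<^sup>2)"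
  by (simp only: ell_norm_sq ell_inner_self)

lemma ell_norm_nonneg [simp]: "ell_norm G u \<ge> 0"
  unfolding ell_norm_def by simp

lemma ell_norm_scale: "ell_norm G (\<lambda>g. c * u g) = norm c * ell_norm G u"
  by (rule power2_eq_imp_eq)
    (simp_all add: power_mult_distrib ell_norm_sq norm_mult sum_distrib_left)

lemma ell_inner_self_eq_0:
  assumes "finite (carrier G)" "u \<in> ell G" "ell_inner G u u = 0"
  shows "u = 0"
proof -
  have "(\<Sum>g\<in>carrier G. (norm (u g))\<^sup>2) = 0"
    using assms(3) by (simp only: ell_inner_self of_real_eq_0_iff)
  then have "\<forall>g\<in>carrier G. u g = 0"
    using assms(1) by (subst (asm) sum_nonneg_eq_0_iff) auto
  then show ?thesis
    using assms(2) unfolding ell_def by fastforce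
qed

lemma ell_lin:
  "(\<And>i. i \<in> I \<Longrightarrow> u i \<in> ell G) \<Longrightarrow> (\<lambda>g. \<Sum>i\<in>I. c i * u i g) \<in> ell G"
  "v \<in> ell G \<Longrightarrow> (\<lambda>g. b * v g) \<in> ell G"
  "v \<in> ell G \<Longrightarrow> w \<in> ell G \<Longrightarrow> (\<lambda>g. v g + w g) \<in> ell G"
  "v \<in> ell G \<Longrightarrow> w \<in> ell G \<Longrightarrow> (\<lambda>g. v g - w g) \<in> ell G"
  "0 \<in> ell G"
  unfolding ell_def by simp_all

lemma subspace_ell: "fun_space.subspace (ell G)"
  unfolding fun_space.subspace_def ell_def by auto

section \<open>Linear dependence of finite families\<close>

text \<open>
More vectors than a spanning set has elements satisfy a nontrivial relation. Families rather than sets are used because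
the relations needed later carry the index of the generator, and different indices may give the same vector.
\<close>

lemma family_dependent:
  fixes x :: "'i \<Rightarrow> 'a \<Rightarrow> 'k::field"
  assumes "finite I" "finite T" "x ` I \<subseteq> fun_space.span T" "card T < card I"
  shows "\<exists>k. (\<exists>i\<in>I. k i \<noteq> 0) \<and> (\<forall>g. (\<Sum>i\<in>I. k i * x i g) = 0)"
proof (cases "inj_on x I")
  case True
  have "fun_space.dependent (x ` I)"
    using fun_space.independent_span_bound[OF assms(2) _ assms(3)] assms(4) card_image[OF True]
    by auto
  then obtain u where u: "\<exists>v\<in>x ` I. u v \<noteq> 0" "(\<Sum>v\<in>x ` I. (\<lambda>g. u v * v g)) = 0"
    using fun_space.dependent_finite[of "x ` I"] assms(1) by auto
  have "(\<Sum>i\<in>I. u (x i) * x i g) = 0" for g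
    using fun_cong[OF u(2), of g] by (simp add: sum_fun_apply sum.reindex[OF True])
  then show ?thesis
    using u(1) by (intro exI[of _ "\<lambda>i. u (x i)"]) auto
next
  case False
  then obtain i j where ij: "i \<in> I" "j \<in> I" "i \<noteq> j" "x i = x j"
    by (auto simp: inj_on_def)
  let ?k = "\<lambda>l. if l = i then 1 else if l = j then -1 else (0::'k)"
  have "(\<Sum>l\<in>I. ?k l * x l g) = 0" for g
  proof -
    have "(\<Sum>l\<in>I. ?k l * x l g) = (\<Sum>l\<in>{i,j}. ?k l * x l g)"
      using ij assms(1) by (intro sum.mono_neutral_right) auto
    then show ?thesis
      using ij by simp
  qed
  then show ?thesis
    using ij by (intro exI[of _ ?k]) auto
qed

lemma independent_relation:
  assumes "finite B" "fun_space.independent B" "\<And>g. (\<Sum>\<beta>\<in>B. k \<beta> * \<beta> g) = 0" "\<beta> \<in> B"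
  shows "k \<beta> = 0"
proof -
  have "(\<Sum>v\<in>B. (\<lambda>g. k v * v g)) = 0"
    using assms(3) by (auto simp: fun_eq_iff sum_fun_apply)
  then show ?thesis
    using fun_space.dependent_finite[OF assms(1)] assms(2,4) by blast
qed

lemma span_sum_mem:
  assumes "\<And>i. i \<in> I \<Longrightarrow> x i \<in> fun_space.span T"
  shows "(\<lambda>g. \<Sum>i\<in>I. c i * x i g) \<in> fun_space.span T"
proof -
  have "(\<Sum>i\<in>I. (\<lambda>g. c i * x i g)) \<in> fun_space.span T"
    using assms by (intro fun_space.span_sum fun_space.span_scale)
  also have "(\<Sum>i\<in>I. (\<lambda>g. c i * x i g)) = (\<lambda>g. \<Sum>i\<in>I. c i * x i g)"
    by (auto simp: sum_fun_apply)
  finally show ?thesis .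
qed

definition delta :: "'a \<Rightarrow> 'a \<Rightarrow> 'k::{zero,one}" where
  "delta x = (\<lambda>y. if y = x then 1 else 0)"

lemma ell_delta_sum:
  assumes "finite (carrier G)" "v \<in> ell G"
  shows "v = (\<lambda>g. \<Sum>x\<in>carrier G. v x * delta x g)"
  using assms unfolding delta_def ell_def by (auto simp: if_distrib cong: if_cong)

lemma ell_subset_span_delta:
  assumes "finite (carrier G)"
  shows "ell G \<subseteq> fun_space.span (delta ` carrier G :: ('a \<Rightarrow> 'k::real_or_complex) set)"
proof
  fix v :: "'a \<Rightarrow> 'k"
  assume "v \<in> ell G"
  then show "v \<in> fun_space.span (delta ` carrier G)"
    by (subst ell_delta_sum[OF assms], assumption, intro span_sum_mem) (auto intro: fun_space.span_base)
qed

text \<open>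
  A vector \<open>v\<close> orthogonal to a basis of the given span solves a homogeneous linear system with
  fewer equations than unknowns: the values \<open>v x\<close> are the coefficients of a linear relation between
  the vectors formed by the conjugated \<open>x\<close>-th entries of the basis elements.
\<close>

lemma exists_orthogonal_to_proper_span:
  fixes X :: "('a \<Rightarrow> 'k::real_or_complex) set"
  assumes fin: "finite (carrier G)" "finite X" and X: "X \<subseteq> ell G"
    and ne: "\<not> ell G \<subseteq> fun_space.span X"
  shows "\<exists>v\<in>ell G. v \<noteq> 0 \<and> (\<forall>w\<in>fun_space.span X. ell_inner G v w = 0)"
proof -
  obtain B where B: "B \<subseteq> X" "fun_space.independent B" "X \<subseteq> fun_space.span B"
    using fun_space.maximal_independent_subset by blast
  have fB: "finite B"
    using B(1) fin(2) finite_subset by blast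
  have spB: "fun_space.span B = fun_space.span X"
    using B by (metis fun_space.span_mono fun_space.span_span subset_antisym)
  obtain z where z: "z \<in> ell G" "z \<notin> fun_space.span X"
    using ne by blast
  then have indz: "fun_space.independent (insert z B)" "z \<notin> B"
    using fun_space.independent_insertI[of z B] B(2) spB fun_space.span_base by auto
  have "card (insert z B) \<le> card (delta ` carrier G :: ('a \<Rightarrow> 'k) set)"
    using fun_space.independent_span_bound[OF _ indz(1), of "delta ` carrier G"] fin(1)
      ell_subset_span_delta[OF fin(1)] X B(1) z(1) by blast
  also have "\<dots> \<le> card (carrier G)"
    by (rule card_image_le[OF fin(1)])
  finally have less: "card B < card (carrier G)"
    using indz(2) fB by simp
  define y :: "'a \<Rightarrow> ('a \<Rightarrow> 'k) \<Rightarrow> 'k"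
    where "y x = (\<lambda>\<beta>. if \<beta> \<in> B then conjugate (\<beta> x) else 0)" for x
  have "y x \<in> fun_space.span (delta ` B)" for x
  proof -
    have "y x = (\<lambda>\<beta>'. \<Sum>\<beta>\<in>B. conjugate (\<beta> x) * delta \<beta> \<beta>')"
      using fB unfolding y_def delta_def by (auto simp: if_distrib cong: if_cong)
    then show ?thesis
      by (simp add: span_sum_mem fun_space.span_base)
  qed
  moreover have "card (delta ` B :: (('a \<Rightarrow> 'k) \<Rightarrow> 'k) set) < card (carrier G)"
    using card_image_le[OF fB, of delta] less by (rule le_less_trans)
  ultimately obtain k where k: "\<exists>x\<in>carrier G. k x \<noteq> 0"
      "\<And>\<beta>. (\<Sum>x\<in>carrier G. k x * y x \<beta>) = 0"
    using family_dependent[OF fin(1), of "delta ` B" y] fB by blast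
  define v where "v = (\<lambda>x. if x \<in> carrier G then k x else 0)"
  have vB: "ell_inner G v \<beta> = 0" if "\<beta> \<in> B" for \<beta>
    using k(2)[of \<beta>] that unfolding ell_inner_def v_def y_def by simp
  have "ell_inner G v w = 0" if "w \<in> fun_space.span X" for w
  proof -
    have "fun_space.subspace {w. ell_inner G v w = 0}"
      unfolding fun_space.subspace_def
      by (simp add: ell_inner_lin_right)
    then show ?thesis
      using that vB spB fun_space.span_minimal[of B "{w. ell_inner G v w = 0}"] by auto
  qed
  moreover have "v \<in> ell G" "v \<noteq> 0"
    using k(1) unfolding v_def ell_def by (auto simp: fun_eq_iff)
  ultimately show ?thesis
    by blast
qed

text \<open>
A relation between \<open>B\<close> and \<open>C\<close> writes a vector of one span as a vector of the other; such a vector is orthogonal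
to itself.
\<close>

lemma independent_Un_orthogonal:
  fixes B C :: "('a \<Rightarrow> 'k::real_or_complex) set"
  assumes fin: "finite (carrier G)" "finite B" "finite C" and sub: "B \<subseteq> ell G" "C \<subseteq> ell G"
    and ind: "fun_space.independent B" "fun_space.independent C"
    and orth: "\<And>\<beta> \<gamma>. \<beta> \<in> B \<Longrightarrow> \<gamma> \<in> C \<Longrightarrow> ell_inner G \<beta> \<gamma> = 0"
  shows "fun_space.independent (B \<union> C) \<and> B \<inter> C = {}"
proof
  show disj: "B \<inter> C = {}"
  proof (rule ccontr)
    assume "B \<inter> C \<noteq> {}"
    then obtain \<beta> where b: "\<beta> \<in> B" "\<beta> \<in> C" by blast
    then have "\<beta> = 0"
      using ell_inner_self_eq_0[OF fin(1)] orth sub(1) by blast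
    then show False
      using b(1) ind(1) fun_space.dependent_zero by blast
  qed
  show "fun_space.independent (B \<union> C)"
  proof
    assume "fun_space.dependent (B \<union> C)"
    then obtain u where u: "\<exists>v\<in>B \<union> C. u v \<noteq> 0" "(\<Sum>v\<in>B \<union> C. (\<lambda>g. u v * v g)) = 0"
      using fun_space.dependent_finite[of "B \<union> C"] fin by blast
    define s where "s D = (\<lambda>g. \<Sum>v\<in>D. u v * v g)" for D
    have sum0: "s B g + s C g = 0" for g
      using fun_cong[OF u(2), of g] sum.union_disjoint[OF fin(2,3) disj, of "\<lambda>v. u v * v g"]
      by (simp add: s_def sum_fun_apply)
    have "ell_inner G (s B) (s C) = 0"
      unfolding s_def by (simp add: ell_inner_sum_left ell_inner_sum_right orth)
    moreover have sC: "s C = (\<lambda>g. (-1) * s B g)"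
      using sum0 by (auto simp: fun_eq_iff eq_neg_iff_add_eq_0 add.commute)
    ultimately have "ell_inner G (s B) (s B) = 0"
      by (simp only: sC ell_inner_lin_right) (simp add: conjugate_minus)
    moreover have "s B \<in> ell G"
      unfolding s_def using sub by (auto intro: ell_lin)
    ultimately have "s B = 0"
      using ell_inner_self_eq_0[OF fin(1)] by blast
    then have "s B g = 0" "s C g = 0" for g
      using sum0[of g] by auto
    then have "u v = 0" if "v \<in> B \<union> C" for v
      using that independent_relation[OF fin(2) ind(1), of u] independent_relation[OF fin(3) ind(2), of u]
      unfolding s_def by blast
    then show False
      using u(1) by blast
  qed
qed

lemma independent_orthogonal:
  fixes X :: "('a \<Rightarrow> 'k::real_or_complex) set"
  assumes fin: "finite (carrier G)" "finite X" and X: "X \<subseteq> ell G" "0 \<notin> X"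
    and orth: "\<And>u v. u \<in> X \<Longrightarrow> v \<in> X \<Longrightarrow> u \<noteq> v \<Longrightarrow> ell_inner G u v = 0"
  shows "fun_space.independent X"
proof
  assume "fun_space.dependent X"
  then obtain c where c: "\<exists>v\<in>X. c v \<noteq> 0" "(\<Sum>v\<in>X. (\<lambda>g. c v * v g)) = 0"
    using fun_space.dependent_finite[OF fin(2)] by blast
  have zero: "(\<lambda>g. \<Sum>v\<in>X. c v * v g) = 0"
    using c(2) by (simp add: fun_eq_iff sum_fun_apply)
  have "c u = 0" if u: "u \<in> X" for u
  proof -
    have "0 = (\<Sum>v\<in>X. c v * ell_inner G v u)"
      using arg_cong[OF zero, of "\<lambda>w. ell_inner G w u"] by (simp add: ell_inner_sum_left ell_inner_lin_left)
    also have "\<dots> = (\<Sum>v\<in>X. if v = u then c u * ell_inner G u u else 0)"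
      using orth u by (intro sum.cong refl) auto
    also have "\<dots> = c u * ell_inner G u u"
      using fin(2) u by simp
    finally show ?thesis
      using ell_inner_self_eq_0[OF fin(1)] X u by (metis mult_eq_0_iff subsetD)
  qed
  then show False
    using c(1) by blast
qed

lemma dim_ell:
  assumes "finite (carrier G)"
  shows "fun_space.dim (ell G :: ('a \<Rightarrow> 'k::real_or_complex) set) = card (carrier G)"
proof -
  let ?B = "delta ` carrier G :: ('a \<Rightarrow> 'k) set"
  have inj: "inj_on (delta :: 'a \<Rightarrow> 'a \<Rightarrow> 'k) (carrier G)"
    by (auto simp: inj_on_def delta_def fun_eq_iff split: if_splits)
  have sub: "?B \<subseteq> ell G"
    by (auto simp: delta_def ell_def)
  have ind: "fun_space.independent ?B"
  proof (rule independent_orthogonal[OF assms _ sub])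
    show "0 \<notin> ?B"
    proof
      assume "0 \<in> ?B"
      then obtain x where "delta x = (0 :: 'a \<Rightarrow> 'k)"
        by auto
      then have "delta x x = (0 :: 'k)"
        by simp
      then show False
        by (simp add: delta_def)
    qed
    show "ell_inner G u v = 0" if "u \<in> ?B" "v \<in> ?B" "u \<noteq> v" for u v
      using that unfolding ell_inner_def by (auto simp: delta_def conjugate_0 intro!: sum.neutral)
  qed (use assms in simp)
  have "card ?B = fun_space.dim (ell G :: ('a \<Rightarrow> 'k) set)"
    by (rule fun_space.basis_card_eq_dim[OF sub ell_subset_span_delta[OF assms] ind])
  then show ?thesis
    by (simp add: card_image[OF inj])
qed

lemma sum_norm_inner_delta:
  assumes "finite (carrier G)"
  shows "(\<Sum>x\<in>carrier G. (norm (ell_inner G (delta x) u))\<^sup>2) = (ell_norm G u)\<^sup>2"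
proof -
  have "ell_inner G (delta x) u = conjugate (u x)" if "x \<in> carrier G" for x
  proof -
    have "ell_inner G (delta x) u = (\<Sum>g\<in>carrier G. if g = x then conjugate (u g) else 0)"
      unfolding ell_inner_def delta_def by (intro sum.cong refl) auto
    then show ?thesis
      using that assms by simp
  qed
  then show ?thesis
    by (simp add: ell_norm_sq)
qed

lemma ell_norm_delta:
  assumes "finite (carrier G)" "x \<in> carrier G"
  shows "(ell_norm G (delta x :: 'a \<Rightarrow> 'k::real_or_complex))\<^sup>2 = 1"
proof -
  have "(ell_norm G (delta x :: 'a \<Rightarrow> 'k))\<^sup>2 = (\<Sum>g\<in>carrier G. if g = x then 1 else 0)"
    unfolding ell_norm_sq delta_def by (intro sum.cong refl) auto
  then show ?thesis
    using assms by simp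
qed

section \<open>The frame operator and the frame potential\<close>

definition frame_operator ::
    "('a, 'b) monoid_scheme \<Rightarrow> 'j set \<Rightarrow> ('j \<Rightarrow> 'a \<Rightarrow> 'k::real_or_complex) \<Rightarrow> ('a \<Rightarrow> 'k) \<Rightarrow> 'a \<Rightarrow> 'k" where
  "frame_operator G J x v = (\<lambda>g. \<Sum>j\<in>J. ell_inner G v (x j) * x j g)"

text \<open>
The matrix of the frame operator with respect to the point masses. Its entries are polynomial in the vectors, which makes
them convenient for computing variations.
\<close>

definition frame_kernel :: "'j set \<Rightarrow> ('j \<Rightarrow> 'a \<Rightarrow> 'k::real_or_complex) \<Rightarrow> 'a \<times> 'a \<Rightarrow> 'k" where
  "frame_kernel J x p = (\<Sum>j\<in>J. x j (fst p) * conjugate (x j (snd p)))"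

lemma frame_operator_in_ell:
  "(\<And>j. j \<in> J \<Longrightarrow> x j \<in> ell G) \<Longrightarrow> frame_operator G J x v \<in> ell G"
  unfolding frame_operator_def by (rule ell_lin)

lemma frame_operator_inner:
  "ell_inner G (frame_operator G J x v) w = (\<Sum>j\<in>J. ell_inner G v (x j) * ell_inner G (x j) w)"
  unfolding frame_operator_def by (rule ell_inner_sum_left)

lemma frame_operator_self_adjoint:
  "ell_inner G (frame_operator G J x v) w = ell_inner G v (frame_operator G J x w)"
  by (subst (2) ell_inner_commute)
    (simp add: frame_operator_inner conjugate_sum conjugate_mult mult.commute flip: ell_inner_commute)

lemma frame_operator_sum:
  "frame_operator G J x (\<lambda>g. \<Sum>i\<in>I. c i * u i g) = (\<lambda>g. \<Sum>i\<in>I. c i * frame_operator G J x (u i) g)"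
proof
  fix g
  have "frame_operator G J x (\<lambda>g. \<Sum>i\<in>I. c i * u i g) g
      = (\<Sum>j\<in>J. \<Sum>i\<in>I. c i * (ell_inner G (u i) (x j) * x j g))"
    unfolding frame_operator_def by (simp add: ell_inner_sum_left sum_distrib_right mult.assoc)
  also have "\<dots> = (\<Sum>i\<in>I. \<Sum>j\<in>J. c i * (ell_inner G (u i) (x j) * x j g))"
    by (rule sum.swap)
  also have "\<dots> = (\<Sum>i\<in>I. c i * frame_operator G J x (u i) g)"
    unfolding frame_operator_def by (simp add: sum_distrib_left)
  finally show "frame_operator G J x (\<lambda>g. \<Sum>i\<in>I. c i * u i g) g
      = (\<Sum>i\<in>I. c i * frame_operator G J x (u i) g)" .
qed

lemma frame_operator_scale:
  "frame_operator G J x (\<lambda>g. c * u g) = (\<lambda>g. c * frame_operator G J x u g)"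
  using frame_operator_sum[of G J x "\<lambda>_. c" "\<lambda>_. u" "{()}"] by simp

lemma frame_operator_add:
  "frame_operator G J x (u + w) = frame_operator G J x u + frame_operator G J x w"
  unfolding frame_operator_def by (auto simp: fun_eq_iff ell_inner_lin_left distrib_right sum.distrib)

lemma frame_operator_zero: "frame_operator G J x 0 = 0"
  unfolding frame_operator_def by (auto simp: fun_eq_iff ell_inner_lin_left)

lemma eigenvectors_orthogonal:
  assumes "frame_operator G J x u = (\<lambda>g. of_real \<alpha> * u g)" "frame_operator G J x v = (\<lambda>g. of_real \<beta> * v g)"
    and "\<alpha> \<noteq> \<beta>"
  shows "ell_inner G u v = 0"
  using frame_operator_self_adjoint[of G J x u v] assms
  by (simp add: ell_inner_lin_left ell_inner_lin_right conjugate_of_real)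

lemma frame_operator_quadratic_form:
  "ell_inner G (frame_operator G J x v) v = of_real (\<Sum>j\<in>J. (norm (ell_inner G v (x j)))\<^sup>2)"
proof -
  have "ell_inner G v (x j) * ell_inner G (x j) v = of_real ((norm (ell_inner G v (x j)))\<^sup>2)" for j
    by (subst (2) ell_inner_commute) (rule mult_conjugate)
  then show ?thesis
    by (simp add: frame_operator_inner)
qed

text \<open>
The Gram matrix and the frame operator of a family have the same Hilbert--Schmidt norm. The frame potential is defined by the
former, but the latter adds up over the vectors, so it is the one to differentiate.
\<close>

lemma frame_potential_eq_kernel_norm:
  "frame_potential G J x = (\<Sum>p\<in>carrier G \<times> carrier G. (norm (frame_kernel J x p))\<^sup>2)"
    for x :: "'j \<Rightarrow> 'a \<Rightarrow> 'k::real_or_complex"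
proof -
  let ?\<phi> = "\<lambda>q p. x (fst q) (fst p) * conjugate (x (snd q) (fst p))
      * (conjugate (x (fst q) (snd p)) * x (snd q) (snd p))"
  have "(of_real (frame_potential G J x) :: 'k)
      = (\<Sum>q\<in>J \<times> J. of_real ((norm (ell_inner G (x (fst q)) (x (snd q))))\<^sup>2))"
    unfolding frame_potential_def by (simp add: sum.cartesian_product case_prod_beta)
  also have "\<dots> = (\<Sum>q\<in>J \<times> J. \<Sum>p\<in>carrier G \<times> carrier G. ?\<phi> q p)"
    unfolding mult_conjugate[symmetric] ell_inner_def
    by (simp add: conjugate_sum conjugate_mult sum_product sum.cartesian_product case_prod_beta)
  also have "\<dots> = (\<Sum>p\<in>carrier G \<times> carrier G. \<Sum>q\<in>J \<times> J. ?\<phi> q p)"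
    by (rule sum.swap)
  also have "\<dots> = (\<Sum>p\<in>carrier G \<times> carrier G. of_real ((norm (frame_kernel J x p))\<^sup>2))"
    unfolding mult_conjugate[symmetric] frame_kernel_def
    by (simp add: conjugate_sum conjugate_mult sum_product sum.cartesian_product case_prod_beta mult_ac)
  finally show ?thesis
    by (simp only: of_real_sum[symmetric] of_real_eq_iff)
qed

text \<open>
The Hilbert--Schmidt product with a rank-one operator is a matrix coefficient. This turns the variations of the frame
potential, which are products of \<open>S\<close> with sums of such operators, into inner products.
\<close>

lemma frame_kernel_pairing:
  "(\<Sum>p\<in>carrier G \<times> carrier G. frame_kernel J x p * conjugate (u (fst p) * conjugate (v (snd p))))
    = ell_inner G (frame_operator G J x v) u"
proof -
  have "ell_inner G (frame_operator G J x v) u = (\<Sum>a\<in>carrier G. \<Sum>j\<in>J. \<Sum>b\<in>carrier G.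
      x j a * conjugate (x j b) * (conjugate (u a) * v b))"
    unfolding frame_operator_def ell_inner_def
    by (simp add: sum_distrib_left sum_distrib_right mult_ac)
  also have "\<dots> = (\<Sum>a\<in>carrier G. \<Sum>b\<in>carrier G. \<Sum>j\<in>J.
      x j a * conjugate (x j b) * (conjugate (u a) * v b))"
    by (intro sum.cong refl sum.swap)
  also have "\<dots> = (\<Sum>p\<in>carrier G \<times> carrier G. frame_kernel J x p * conjugate (u (fst p) * conjugate (v (snd p))))"
    unfolding frame_kernel_def
    by (subst sum.cartesian_product) (simp add: case_prod_beta sum_distrib_right conjugate_mult)
  finally show ?thesis ..
qed

section \<open>Variations\<close>

text \<open>
The derivative of \<open>s \<mapsto> \<parallel>P + s R\<parallel>\<^sup>2\<close> at \<open>s = 0\<close> is twice the real part of \<open>\<langle>P, R\<rangle>\<close>, and it cannot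
be negative at a minimum. The direction \<open>R\<close> is only approached as \<open>t\<close> tends to \<open>0\<close>, and the speed \<open>s t\<close> is free,
so that the lemma serves both a first variation, with \<open>s t = t\<close>, and a second one, with \<open>s t = t\<^sup>2\<close>. The pairing is
assumed to be real, which holds in both cases.
\<close>

lemma one_sided_variation:
  fixes P R :: "'i \<Rightarrow> 'k::real_or_complex" and Rt :: "real \<Rightarrow> 'i \<Rightarrow> 'k"
  assumes lim: "\<And>i. i \<in> I \<Longrightarrow> ((\<lambda>t. Rt t i) \<longlongrightarrow> R i) (at_right 0)"
    and s: "(s \<longlongrightarrow> 0) (at_right 0)" "eventually (\<lambda>t. s t > 0) (at_right 0)"
    and min: "eventually (\<lambda>t. (\<Sum>i\<in>I. (norm (P i))\<^sup>2)
        \<le> (\<Sum>i\<in>I. (norm (P i + of_real (s t) * Rt t i))\<^sup>2)) (at_right 0)"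
    and c: "of_real c = (\<Sum>i\<in>I. P i * conjugate (R i))"
  shows "0 \<le> c"
proof -
  define D where "D t = ((\<Sum>i\<in>I. (norm (P i + of_real (s t) * Rt t i))\<^sup>2)
      - (\<Sum>i\<in>I. (norm (P i))\<^sup>2)) / s t" for t
  define E :: "real \<Rightarrow> 'k" where "E t = (\<Sum>i\<in>I. P i * conjugate (Rt t i) + Rt t i * conjugate (P i)
      + of_real (s t) * (Rt t i * conjugate (Rt t i)))" for t
  have DE: "of_real (D t) = E t" if "s t > 0" for t
  proof -
    have "of_real ((norm (P i + of_real (s t) * Rt t i))\<^sup>2) = of_real ((norm (P i))\<^sup>2)
        + of_real (s t) * (P i * conjugate (Rt t i) + Rt t i * conjugate (P i)
          + of_real (s t) * (Rt t i * conjugate (Rt t i)))" for i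
      unfolding mult_conjugate[symmetric] conjugate_add conjugate_mult conjugate_of_real
      by (simp add: algebra_simps)
    then have "of_real (\<Sum>i\<in>I. (norm (P i + of_real (s t) * Rt t i))\<^sup>2)
        = of_real (\<Sum>i\<in>I. (norm (P i))\<^sup>2) + of_real (s t) * E t"
      unfolding E_def of_real_sum sum_distrib_left sum.distrib[symmetric] by (intro sum.cong refl)
    then have "of_real (D t) = of_real (s t) * E t / of_real (s t)"
      unfolding D_def by (simp only: of_real_divide of_real_diff add_diff_cancel_left')
    then show ?thesis
      using that by simp
  qed
  have "(E \<longlongrightarrow> (\<Sum>i\<in>I. P i * conjugate (R i) + R i * conjugate (P i)
      + of_real 0 * (R i * conjugate (R i)))) (at_right 0)"
    unfolding E_def by (intro tendsto_intros lim s)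
  also have "(\<Sum>i\<in>I. P i * conjugate (R i) + R i * conjugate (P i) + of_real 0 * (R i * conjugate (R i)))
      = (\<Sum>i\<in>I. P i * conjugate (R i)) + conjugate (\<Sum>i\<in>I. P i * conjugate (R i))"
    by (simp add: conjugate_sum conjugate_mult sum.distrib mult.commute)
  also have "\<dots> = of_real (2 * c)"
    unfolding c[symmetric] by (simp add: conjugate_of_real)
  finally have "(E \<longlongrightarrow> of_real (2 * c)) (at_right 0)" .
  moreover have "eventually (\<lambda>t. E t = of_real (D t)) (at_right 0)"
    using s(2) by eventually_elim (simp add: DE)
  ultimately have "((\<lambda>t. of_real (D t) :: 'k) \<longlongrightarrow> of_real (2 * c)) (at_right 0)"
    by (rule Lim_transform_eventually)
  then have "(D \<longlongrightarrow> 2 * c) (at_right 0)"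
    by (simp only: tendsto_of_real_iff)
  moreover have "eventually (\<lambda>t. 0 \<le> D t) (at_right 0)"
    using s(2) min by eventually_elim (simp add: D_def)
  ultimately have "0 \<le> 2 * c"
    by (rule tendsto_lowerbound) (simp add: trivial_limit_at_right_real)
  then show ?thesis
    by simp
qed

text \<open>
If \<open>y j\<close> is orthogonal to \<open>x j\<close> and \<open>\<gamma> j = \<parallel>y j\<parallel>\<^sup>2 / \<parallel>x j\<parallel>\<^sup>2\<close>, then the perturbed vector has the
norm of \<open>x j\<close>. Only the square of the scaling factor enters the kernel, which therefore stays rational in \<open>t\<close>.
\<close>

definition rescaled_perturbation :: "('j \<Rightarrow> real) \<Rightarrow> ('j \<Rightarrow> 'a \<Rightarrow> 'k::real_or_complex) \<Rightarrow> ('j \<Rightarrow> 'a \<Rightarrow> 'k)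
    \<Rightarrow> real \<Rightarrow> 'j \<Rightarrow> 'a \<Rightarrow> 'k" where
  "rescaled_perturbation \<gamma> x y t j = (\<lambda>g. of_real (1 / sqrt (1 + t\<^sup>2 * \<gamma> j)) * (x j g + of_real t * y j g))"

lemma weight_identity:
  assumes "\<gamma> \<ge> 0"
  shows "1 / (1 + t\<^sup>2 * \<gamma>) = 1 - t\<^sup>2 * \<gamma> * (1 / (1 + t\<^sup>2 * \<gamma>) :: real)"
proof -
  have "1 + t\<^sup>2 * \<gamma> > 0"
    using assms by (simp add: add_pos_nonneg)
  then show ?thesis
    by (simp add: field_simps)
qed

lemma rescaled_product:
  assumes "\<gamma> j \<ge> 0"
  shows "rescaled_perturbation \<gamma> x y t j a * conjugate (rescaled_perturbation \<gamma> x y t j b)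
    = of_real (1 / (1 + t\<^sup>2 * \<gamma> j)) * ((x j a + of_real t * y j a)
        * (conjugate (x j b) + of_real t * conjugate (y j b)))"
proof -
  have "1 + t\<^sup>2 * \<gamma> j > 0"
    using assms by (simp add: add_pos_nonneg)
  then have "1 / (1 + t\<^sup>2 * \<gamma> j) = 1 / sqrt (1 + t\<^sup>2 * \<gamma> j) * (1 / sqrt (1 + t\<^sup>2 * \<gamma> j))"
    by simp
  then show ?thesis
    unfolding rescaled_perturbation_def conjugate_mult conjugate_of_real conjugate_add
    by (simp only: of_real_mult mult_ac)
qed

lemma kernel_rescaled_first_order:
  fixes x y :: "'j \<Rightarrow> 'a \<Rightarrow> 'k::real_or_complex"
  assumes "\<And>j. j \<in> J \<Longrightarrow> \<gamma> j \<ge> 0"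
  shows "frame_kernel J (rescaled_perturbation \<gamma> x y t) p = frame_kernel J x p
    + of_real t * (\<Sum>j\<in>J. of_real (1 / (1 + t\<^sup>2 * \<gamma> j))
        * (x j (fst p) * conjugate (y j (snd p)) + y j (fst p) * conjugate (x j (snd p))
          + of_real t * (y j (fst p) * conjugate (y j (snd p)))
          - of_real (t * \<gamma> j) * (x j (fst p) * conjugate (x j (snd p)))))"
proof -
  have alg: "W * ((X + T * Y) * (X' + T * Y'))
      = X * X' + T * (W * (X * Y' + Y * X' + T * (Y * Y') - T * g * (X * X')))"
    if "W = 1 - T\<^sup>2 * g * W" for W T g X X' Y Y' :: 'k
    using that by algebra
  have "of_real (1 / (1 + t\<^sup>2 * \<gamma> j)) = (1 - (of_real t)\<^sup>2 * of_real (\<gamma> j) * of_real (1 / (1 + t\<^sup>2 * \<gamma> j)) :: 'k)"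
    if "j \<in> J" for j
    using arg_cong[OF weight_identity[OF assms[OF that], of t], of "of_real :: real \<Rightarrow> 'k"]
    by (simp only: of_real_diff of_real_mult of_real_power of_real_1)
  note step = alg[OF this]
  show ?thesis
    unfolding frame_kernel_def sum_distrib_left sum.distrib[symmetric]
    by (rule sum.cong[OF refl]) (simp only: rescaled_product assms step of_real_mult)
qed

text \<open>
When the mixed terms cancel in the sum over \<open>j\<close>, they still reappear through the weights, which differ from one
another; but the weights are \<open>1 + O(t\<^sup>2)\<close>, so this contribution has order \<open>t\<^sup>3\<close>.
\<close>

lemma kernel_rescaled_second_order:
  fixes x y :: "'j \<Rightarrow> 'a \<Rightarrow> 'k::real_or_complex"
  assumes "\<And>j. j \<in> J \<Longrightarrow> \<gamma> j \<ge> 0"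
    and cross: "(\<Sum>j\<in>J. x j (fst p) * conjugate (y j (snd p)) + y j (fst p) * conjugate (x j (snd p))) = 0"
  shows "frame_kernel J (rescaled_perturbation \<gamma> x y t) p = frame_kernel J x p
    + of_real (t\<^sup>2) * (\<Sum>j\<in>J. of_real (1 / (1 + t\<^sup>2 * \<gamma> j))
        * (y j (fst p) * conjugate (y j (snd p))
          - of_real (\<gamma> j) * (x j (fst p) * conjugate (x j (snd p)))
          - of_real (t * \<gamma> j) * (x j (fst p) * conjugate (y j (snd p)) + y j (fst p) * conjugate (x j (snd p)))))"
proof -
  have alg: "W * ((X + T * Y) * (X' + T * Y'))
      = X * X' + T * (X * Y' + Y * X') + T\<^sup>2 * (W * (Y * Y' - g * (X * X') - T * g * (X * Y' + Y * X')))"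
    if "W = 1 - T\<^sup>2 * g * W" for W T g X X' Y Y' :: 'k
    using that by algebra
  have "of_real (1 / (1 + t\<^sup>2 * \<gamma> j)) = (1 - (of_real t)\<^sup>2 * of_real (\<gamma> j) * of_real (1 / (1 + t\<^sup>2 * \<gamma> j)) :: 'k)"
    if "j \<in> J" for j
    using arg_cong[OF weight_identity[OF assms(1)[OF that], of t], of "of_real :: real \<Rightarrow> 'k"]
    by (simp only: of_real_diff of_real_mult of_real_power of_real_1)
  note step = alg[OF this]
  have "frame_kernel J (rescaled_perturbation \<gamma> x y t) p = frame_kernel J x p
    + of_real t * (\<Sum>j\<in>J. x j (fst p) * conjugate (y j (snd p)) + y j (fst p) * conjugate (x j (snd p)))
    + of_real (t\<^sup>2) * (\<Sum>j\<in>J. of_real (1 / (1 + t\<^sup>2 * \<gamma> j))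
        * (y j (fst p) * conjugate (y j (snd p))
          - of_real (\<gamma> j) * (x j (fst p) * conjugate (x j (snd p)))
          - of_real (t * \<gamma> j) * (x j (fst p) * conjugate (y j (snd p)) + y j (fst p) * conjugate (x j (snd p)))))"
    unfolding frame_kernel_def sum_distrib_left sum.distrib[symmetric]
    by (rule sum.cong[OF refl]) (simp only: rescaled_product assms step of_real_mult of_real_power)
  then show ?thesis
    by (simp only: cross) simp
qed

lemma tendsto_weight: "((\<lambda>t. of_real (1 / (1 + t\<^sup>2 * \<gamma>)) :: 'k::real_or_complex) \<longlongrightarrow> 1) (at_right 0)"
proof -
  have "((\<lambda>t. of_real (1 / (1 + t\<^sup>2 * \<gamma>)) :: 'k) \<longlongrightarrow> of_real (1 / (1 + 0\<^sup>2 * \<gamma>))) (at_right 0)"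
    by (intro tendsto_intros) auto
  then show ?thesis
    by simp
qed

lemma first_variation:
  fixes x y :: "'j \<Rightarrow> 'a \<Rightarrow> 'k::real_or_complex"
  assumes \<gamma>: "\<And>j. j \<in> J \<Longrightarrow> \<gamma> j \<ge> 0"
    and min: "eventually (\<lambda>t. frame_potential G J x
        \<le> frame_potential G J (rescaled_perturbation \<gamma> x y t)) (at_right 0)"
    and c: "of_real c = (\<Sum>j\<in>J. ell_inner G (frame_operator G J x (y j)) (x j)
        + ell_inner G (frame_operator G J x (x j)) (y j))"
  shows "0 \<le> c"
proof (rule one_sided_variation)
  let ?I = "carrier G \<times> carrier G"
  show "((\<lambda>t. \<Sum>j\<in>J. of_real (1 / (1 + t\<^sup>2 * \<gamma> j))
        * (x j (fst p) * conjugate (y j (snd p)) + y j (fst p) * conjugate (x j (snd p))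
          + of_real t * (y j (fst p) * conjugate (y j (snd p)))
          - of_real (t * \<gamma> j) * (x j (fst p) * conjugate (x j (snd p)))))
    \<longlongrightarrow> (\<Sum>j\<in>J. 1 * (x j (fst p) * conjugate (y j (snd p)) + y j (fst p) * conjugate (x j (snd p))
          + of_real 0 * (y j (fst p) * conjugate (y j (snd p)))
          - of_real (0 * \<gamma> j) * (x j (fst p) * conjugate (x j (snd p)))))) (at_right 0)" for p
    by (intro tendsto_intros tendsto_weight)
  show "((\<lambda>t. t) \<longlongrightarrow> (0::real)) (at_right 0)"
    by (rule tendsto_ident_at)
  show "eventually (\<lambda>t::real. t > 0) (at_right 0)"
    by (simp add: eventually_at_right_less)
  show "eventually (\<lambda>t. (\<Sum>p\<in>?I. (norm (frame_kernel J x p))\<^sup>2)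
      \<le> (\<Sum>p\<in>?I. (norm (frame_kernel J x p + of_real t * (\<Sum>j\<in>J. of_real (1 / (1 + t\<^sup>2 * \<gamma> j))
        * (x j (fst p) * conjugate (y j (snd p)) + y j (fst p) * conjugate (x j (snd p))
          + of_real t * (y j (fst p) * conjugate (y j (snd p)))
          - of_real (t * \<gamma> j) * (x j (fst p) * conjugate (x j (snd p)))))))\<^sup>2)) (at_right 0)"
    using min by (simp only: frame_potential_eq_kernel_norm kernel_rescaled_first_order[OF \<gamma>])
  have "(\<Sum>p\<in>?I. frame_kernel J x p * conjugate (\<Sum>j\<in>J. x j (fst p) * conjugate (y j (snd p))
          + y j (fst p) * conjugate (x j (snd p))))
      = (\<Sum>p\<in>?I. \<Sum>j\<in>J. frame_kernel J x p * conjugate (x j (fst p) * conjugate (y j (snd p)))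
          + frame_kernel J x p * conjugate (y j (fst p) * conjugate (x j (snd p))))"
    by (simp only: conjugate_sum conjugate_add sum_distrib_left distrib_left)
  also have "\<dots> = of_real c"
    unfolding c by (subst sum.swap) (simp only: sum.distrib frame_kernel_pairing)
  finally show "of_real c = (\<Sum>p\<in>?I. frame_kernel J x p * conjugate (\<Sum>j\<in>J. 1 * (x j (fst p) * conjugate (y j (snd p))
          + y j (fst p) * conjugate (x j (snd p))
          + of_real 0 * (y j (fst p) * conjugate (y j (snd p)))
          - of_real (0 * \<gamma> j) * (x j (fst p) * conjugate (x j (snd p))))))"
    by simp
qed

lemma second_variation:
  fixes x y :: "'j \<Rightarrow> 'a \<Rightarrow> 'k::real_or_complex"
  assumes \<gamma>: "\<And>j. j \<in> J \<Longrightarrow> \<gamma> j \<ge> 0"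
    and min: "eventually (\<lambda>t. frame_potential G J x
        \<le> frame_potential G J (rescaled_perturbation \<gamma> x y t)) (at_right 0)"
    and cross: "\<And>a b. (\<Sum>j\<in>J. x j a * conjugate (y j b) + y j a * conjugate (x j b)) = 0"
    and c: "of_real c = (\<Sum>j\<in>J. ell_inner G (frame_operator G J x (y j)) (y j)
        - of_real (\<gamma> j) * ell_inner G (frame_operator G J x (x j)) (x j))"
  shows "0 \<le> c"
proof (rule one_sided_variation)
  let ?I = "carrier G \<times> carrier G"
  show "((\<lambda>t. \<Sum>j\<in>J. of_real (1 / (1 + t\<^sup>2 * \<gamma> j))
        * (y j (fst p) * conjugate (y j (snd p))
          - of_real (\<gamma> j) * (x j (fst p) * conjugate (x j (snd p)))
          - of_real (t * \<gamma> j) * (x j (fst p) * conjugate (y j (snd p)) + y j (fst p) * conjugate (x j (snd p)))))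
    \<longlongrightarrow> (\<Sum>j\<in>J. 1 * (y j (fst p) * conjugate (y j (snd p))
          - of_real (\<gamma> j) * (x j (fst p) * conjugate (x j (snd p)))
          - of_real (0 * \<gamma> j) * (x j (fst p) * conjugate (y j (snd p)) + y j (fst p) * conjugate (x j (snd p))))))
      (at_right 0)" for p
    by (intro tendsto_intros tendsto_weight)
  have "((\<lambda>t. t\<^sup>2) \<longlongrightarrow> (0::real)\<^sup>2) (at_right 0)"
    by (intro tendsto_intros)
  then show "((\<lambda>t. t\<^sup>2) \<longlongrightarrow> (0::real)) (at_right 0)"
    by simp
  show "eventually (\<lambda>t::real. t\<^sup>2 > 0) (at_right 0)"
    using eventually_at_right_less[of "0::real"] by eventually_elim simp
  show "eventually (\<lambda>t. (\<Sum>p\<in>?I. (norm (frame_kernel J x p))\<^sup>2)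
      \<le> (\<Sum>p\<in>?I. (norm (frame_kernel J x p + of_real (t\<^sup>2) * (\<Sum>j\<in>J. of_real (1 / (1 + t\<^sup>2 * \<gamma> j))
        * (y j (fst p) * conjugate (y j (snd p))
          - of_real (\<gamma> j) * (x j (fst p) * conjugate (x j (snd p)))
          - of_real (t * \<gamma> j) * (x j (fst p) * conjugate (y j (snd p)) + y j (fst p) * conjugate (x j (snd p)))))))\<^sup>2))
      (at_right 0)"
    using min by (simp only: frame_potential_eq_kernel_norm kernel_rescaled_second_order[OF \<gamma> cross])
  have "(\<Sum>p\<in>?I. frame_kernel J x p * conjugate (\<Sum>j\<in>J. y j (fst p) * conjugate (y j (snd p))
          - of_real (\<gamma> j) * (x j (fst p) * conjugate (x j (snd p)))))
      = (\<Sum>p\<in>?I. \<Sum>j\<in>J. frame_kernel J x p * conjugate (y j (fst p) * conjugate (y j (snd p)))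
          - of_real (\<gamma> j) * (frame_kernel J x p * conjugate (x j (fst p) * conjugate (x j (snd p)))))"
    unfolding conjugate_sum conjugate_diff conjugate_mult[of "of_real _"] conjugate_of_real
      sum_distrib_left right_diff_distrib by (simp only: mult.left_commute)
  also have "\<dots> = of_real c"
    unfolding c
    by (subst sum.swap) (simp only: sum_subtractf sum_distrib_left[symmetric] frame_kernel_pairing)
  finally show "of_real c = (\<Sum>p\<in>?I. frame_kernel J x p * conjugate (\<Sum>j\<in>J. 1 * (y j (fst p) * conjugate (y j (snd p))
          - of_real (\<gamma> j) * (x j (fst p) * conjugate (x j (snd p)))
          - of_real (0 * \<gamma> j) * (x j (fst p) * conjugate (y j (snd p)) + y j (fst p) * conjugate (x j (snd p))))))"
    by simp
qed

section \<open>Convolution by functions on the subgroup\<close>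

locale convolution_setting = comm_group G for G (structure) +
  fixes H :: "'a set"
  assumes finite_carrier: "finite (carrier G)" and subgroup_H: "subgroup H G"
begin

lemma H_subset: "H \<subseteq> carrier G"
  by (rule subgroup.subset[OF subgroup_H])

lemma H_closed [simp, intro]:
  "h \<in> H \<Longrightarrow> h \<in> carrier G" "h \<in> H \<Longrightarrow> k \<in> H \<Longrightarrow> h \<otimes> k \<in> H" "h \<in> H \<Longrightarrow> inv h \<in> H" "\<one> \<in> H"
  using subgroup_H H_subset by (auto intro: subgroup.m_closed subgroup.m_inv_closed subgroup.one_closed)

lemma finite_H [simp]: "finite H"
  using finite_carrier H_subset finite_subset by blast

text \<open>
The cancellation laws of a commutative group in the shapes that occur when sums are reindexed by translations.
\<close>

lemma cancel_inv [simp]: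
  assumes "x \<in> carrier G" "h \<in> carrier G"
  shows "x \<otimes> h \<otimes> inv h = x" "x \<otimes> inv h \<otimes> h = x" "h \<otimes> x \<otimes> inv h = x"
    "h \<otimes> (inv h \<otimes> x) = x" "inv h \<otimes> (h \<otimes> x) = x"
proof -
  show "x \<otimes> h \<otimes> inv h = x" "x \<otimes> inv h \<otimes> h = x"
    using assms by (simp_all add: m_assoc)
  show "h \<otimes> x \<otimes> inv h = x"
    using assms by (simp add: m_comm[of h x] m_assoc)
  show "h \<otimes> (inv h \<otimes> x) = x" "inv h \<otimes> (h \<otimes> x) = x"
    using assms by (simp_all flip: m_assoc)
qed

lemma sum_shift_carrier:
  assumes "h \<in> carrier G"
  shows "(\<Sum>x\<in>carrier G. \<phi> (x \<otimes> inv h)) = (\<Sum>x\<in>carrier G. \<phi> x)"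
  by (rule sum.reindex_bij_witness[where i = "\<lambda>x. x \<otimes> h" and j = "\<lambda>x. x \<otimes> inv h"])
    (use assms in auto)

lemma sum_shift_H:
  assumes "k \<in> H"
  shows "(\<Sum>h\<in>H. \<phi> (k \<otimes> h)) = (\<Sum>h\<in>H. \<phi> h)"
  by (rule sum.reindex_bij_witness[where i = "\<lambda>h. inv k \<otimes> h" and j = "\<lambda>h. k \<otimes> h"])
    (use assms in auto)

lemma sum_inv_H: "(\<Sum>h\<in>H. \<phi> (inv h)) = (\<Sum>h\<in>H. \<phi> h)"
  by (rule sum.reindex_bij_witness[where i = "\<lambda>h. inv h" and j = "\<lambda>h. inv h"]) auto

lemma translation_in_ell [simp]: "translation G h f \<in> ell G"
  unfolding translation_def ell_def by simp

lemma translation_one: "f \<in> ell G \<Longrightarrow> translation G \<one> f = f"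
  unfolding translation_def ell_def by auto

lemma translation_translation:
  assumes "h \<in> carrier G" "k \<in> carrier G"
  shows "translation G h (translation G k f) = translation G (h \<otimes> k) f"
  using assms unfolding translation_def by (auto simp: inv_mult m_assoc)

lemma translation_sum:
  "translation G h (\<lambda>g. \<Sum>i\<in>I. c i * u i g) = (\<lambda>g. \<Sum>i\<in>I. c i * translation G h (u i) g)"
  unfolding translation_def by auto

lemma inner_translation_adjoint:
  assumes "h \<in> carrier G"
  shows "ell_inner G (translation G h u) v = ell_inner G u (translation G (inv h) v)"
  using sum_shift_carrier[OF assms, of "\<lambda>x. u x * conjugate (v (x \<otimes> h))"] assms
  unfolding ell_inner_def translation_def by simp

lemma inner_translation_translation:
  assumes "h \<in> carrier G"
  shows "ell_inner G (translation G h u) (translation G h v) = ell_inner G u v"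
  using sum_shift_carrier[OF assms, of "\<lambda>x. u x * conjugate (v x)"] assms
  unfolding ell_inner_def translation_def by simp

text \<open>
Convolution of \<open>v\<close> by the restriction of \<open>b\<close> to \<open>H\<close>. For functions in \<open>supported\<close> it is also the
multiplication of the convolution algebra of \<open>H\<close>, and \<open>star\<close> is the involution of that algebra.
\<close>

definition act :: "('a \<Rightarrow> 'k::real_or_complex) \<Rightarrow> ('a \<Rightarrow> 'k) \<Rightarrow> 'a \<Rightarrow> 'k" where
  "act b v = (\<lambda>x. \<Sum>h\<in>H. b h * translation G h v x)"

definition supported :: "('a \<Rightarrow> 'k::real_or_complex) set" where
  "supported = {b. \<forall>x. x \<notin> H \<longrightarrow> b x = 0}"

definition star :: "('a \<Rightarrow> 'k::real_or_complex) \<Rightarrow> 'a \<Rightarrow> 'k" where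
  "star b = (\<lambda>h. if h \<in> H then conjugate (b (inv h)) else 0)"

lemma act_in_ell [simp]: "act b v \<in> ell G"
  unfolding act_def by (rule ell_lin) simp

lemma act_sum: "act b (\<lambda>g. \<Sum>i\<in>I. c i * u i g) = (\<lambda>g. \<Sum>i\<in>I. c i * act b (u i) g)"
proof -
  have "(\<Sum>h\<in>H. b h * (\<Sum>i\<in>I. c i * translation G h (u i) g))
      = (\<Sum>h\<in>H. \<Sum>i\<in>I. c i * (b h * translation G h (u i) g))" for g
    by (simp add: sum_distrib_left mult_ac)
  also have "\<dots> g = (\<Sum>i\<in>I. \<Sum>h\<in>H. c i * (b h * translation G h (u i) g))" for g
    by (rule sum.swap)
  finally show ?thesis
    unfolding act_def translation_sum by (simp add: sum_distrib_left)
qed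

lemma act_sum_left: "act (\<lambda>g. \<Sum>i\<in>I. c i * b i g) v = (\<lambda>g. \<Sum>i\<in>I. c i * act (b i) v g)"
proof -
  have "(\<Sum>h\<in>H. (\<Sum>i\<in>I. c i * b i h) * translation G h v g)
      = (\<Sum>h\<in>H. \<Sum>i\<in>I. c i * (b i h * translation G h v g))" for g
    by (simp add: sum_distrib_right mult.assoc)
  also have "\<dots> g = (\<Sum>i\<in>I. \<Sum>h\<in>H. c i * (b i h * translation G h v g))" for g
    by (rule sum.swap)
  finally show ?thesis
    unfolding act_def by (simp add: sum_distrib_left)
qed

lemma act_zero: "act b 0 = 0"
  unfolding act_def translation_def zero_fun_def by simp

lemma act_plus: "act b (u + w) = act b u + act b w"
proof
  fix x
  show "act b (u + w) x = (act b u + act b w) x"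
    by (cases "x \<in> carrier G") (simp_all add: act_def translation_def distrib_left sum.distrib)
qed

lemma act_translation:
  assumes "k \<in> carrier G"
  shows "act b (translation G k v) = translation G k (act b v)"
proof -
  have "translation G h (translation G k v) = translation G k (translation G h v)" if "h \<in> H" for h
    using assms that by (simp add: translation_translation m_comm[of h k])
  then show ?thesis
    unfolding act_def translation_sum by simp
qed

lemma act_translation_left:
  assumes "h \<in> H"
  shows "act (translation G h b) v = act b (translation G h v)"
proof -
  have "(\<Sum>k\<in>H. translation G h b k * translation G k v x)
      = (\<Sum>k\<in>H. translation G h b (h \<otimes> k) * translation G (h \<otimes> k) v x)" for x
    by (rule sum_shift_H[OF assms, symmetric])
  also have "\<dots> x = (\<Sum>k\<in>H. b k * translation G k (translation G h v) x)" for x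
    using assms by (intro sum.cong refl)
      (simp add: translation_translation m_comm[of h] , simp add: translation_def)
  finally show ?thesis
    unfolding act_def by simp
qed

lemma inner_act: "ell_inner G (act b v) w = ell_inner G v (act (star b) w)"
proof -
  have "ell_inner G (act b v) w = (\<Sum>h\<in>H. b (inv (inv h)) * ell_inner G v (translation G (inv h) w))"
    unfolding act_def by (simp add: ell_inner_sum_left inner_translation_adjoint)
  also have "\<dots> = (\<Sum>h\<in>H. b (inv h) * ell_inner G v (translation G h w))"
    by (rule sum_inv_H)
  also have "\<dots> = ell_inner G v (act (star b) w)"
    unfolding act_def star_def by (simp add: ell_inner_sum_right)
  finally show ?thesis .
qed

lemma supported_subset_ell: "b \<in> supported \<Longrightarrow> b \<in> ell G"
  unfolding supported_def ell_def by auto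

lemma star_supported [simp]: "star b \<in> supported"
  unfolding supported_def star_def by simp

lemma star_star: "b \<in> supported \<Longrightarrow> star (star b) = b"
  unfolding supported_def star_def by auto

lemma translation_supported:
  assumes "h \<in> H" "b \<in> supported"
  shows "translation G h b \<in> supported"
proof -
  have "x \<in> H" if "x \<in> carrier G" "x \<otimes> inv h \<in> H" for x
    using H_closed(2)[OF that(2) assms(1)] that(1) assms(1) by simp
  then have "x \<otimes> inv h \<notin> H" if "x \<notin> H" "x \<in> carrier G" for x
    using that by blast
  then show ?thesis
    using assms(2) unfolding supported_def translation_def by simp
qed

lemma supported_sum: "(\<And>i. i \<in> I \<Longrightarrow> b i \<in> supported) \<Longrightarrow> (\<lambda>g. \<Sum>i\<in>I. c i * b i g) \<in> supported"
  unfolding supported_def by simp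

lemma act_delta_one:
  assumes "b \<in> supported"
  shows "act b (delta \<one>) = b"
proof
  fix x
  have eq: "x \<otimes> inv h = \<one> \<longleftrightarrow> h = x" if "x \<in> carrier G" "h \<in> H" for h
  proof
    assume "x \<otimes> inv h = \<one>"
    then have "x \<otimes> inv h \<otimes> h = \<one> \<otimes> h" by simp
    then show "h = x" using that by simp
  qed (use that in \<open>simp\<close>)
  show "act b (delta \<one>) x = b x"
  proof (cases "x \<in> carrier G")
    case True
    then have "act b (delta \<one>) x = (\<Sum>h\<in>H. if h = x then b h else 0)"
      unfolding act_def translation_def delta_def by (intro sum.cong refl) (simp add: eq)
    then show ?thesis
      using assms by (simp add: supported_def)
  next
    case False
    then show ?thesis
      using assms unfolding act_def translation_def supported_def by auto
  qed
qed

text \<open>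
The value of \<open>b\<^sup>* * b\<close> at the unit of \<open>G\<close> is \<open>\<parallel>b\<parallel>\<^sup>2\<close>.
\<close>

lemma eq_0_if_star_act_eq_0:
  assumes b: "b \<in> supported" and 0: "act (star b) b = 0"
  shows "b = 0"
proof -
  have "ell_inner G b b = ell_inner G (delta \<one>) (act (star b) b)"
    by (metis act_delta_one[OF b] inner_act)
  then show ?thesis
    using ell_inner_self_eq_0[OF finite_carrier supported_subset_ell[OF b]]
    by (simp add: 0 ell_inner_lin_right)
qed

section \<open>Freeness over the convolution algebra of the subgroup\<close>

lemma coset_representatives:
  obtains R where "R \<subseteq> carrier G" "finite R" "card R = card (rcosets H)"
    "\<And>x. x \<in> carrier G \<Longrightarrow> \<exists>h\<in>H. \<exists>r\<in>R. x = h \<otimes> r"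
    "\<And>r r' h. r \<in> R \<Longrightarrow> r' \<in> R \<Longrightarrow> h \<in> H \<Longrightarrow> h \<otimes> r \<otimes> inv r' \<in> H \<Longrightarrow> r = r'"
proof -
  define rep where "rep C = (SOME x. x \<in> C)" for C :: "'a set"
  have rep: "rep C \<in> C" if "C \<in> rcosets H" for C
    unfolding rep_def using subgroup.rcosets_non_empty[OF subgroup_H that] by (simp add: some_in_eq)
  have car: "C \<subseteq> carrier G" if "C \<in> rcosets H" for C
    using subgroup.rcosets_carrier[OF subgroup_H is_group that] .
  have coset: "H #> rep C = C" if C: "C \<in> rcosets H" for C
  proof -
    obtain a where a: "a \<in> carrier G" "C = H #> a"
      using C unfolding RCOSETS_def by auto
    then show ?thesis
      using repr_independence[OF _ a(1) subgroup_H] rep[OF C] by simp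
  qed
  let ?R = "rep ` (rcosets H)"
  have card: "card ?R = card (rcosets H)"
    by (intro card_image) (metis coset inj_onI)
  have sub: "?R \<subseteq> carrier G"
    using rep car by auto
  have cover: "\<exists>h\<in>H. \<exists>r\<in>rep ` (rcosets H). x = h \<otimes> r" if "x \<in> carrier G" for x
  proof -
    have C: "H #> x \<in> rcosets H"
      using rcosetsI[OF H_subset that] .
    have "x \<in> H #> x"
      using rcos_self[OF that subgroup_H] .
    then show ?thesis
      using coset[OF C] C unfolding r_coset_def by blast
  qed
  have unique: "r = r'" if r: "r \<in> rep ` (rcosets H)" "r' \<in> rep ` (rcosets H)"
    and h: "h \<in> H" "h \<otimes> r \<otimes> inv r' \<in> H" for r r' h
  proof -
    obtain C D where C: "C \<in> rcosets H" "r = rep C" and D: "D \<in> rcosets H" "r' = rep D"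
      using r by auto
    have rc: "r \<in> carrier G" "r' \<in> carrier G"
      using C D rep car by auto
    have "h \<otimes> r = (h \<otimes> r \<otimes> inv r') \<otimes> r'"
      using rc h(1) by simp
    then have "h \<otimes> r \<in> H #> r'"
      using h(2) unfolding r_coset_def by blast
    moreover have "h \<otimes> r \<in> H #> r"
      using h(1) unfolding r_coset_def by blast
    ultimately have "C \<inter> D \<noteq> {}"
      using coset C D by auto
    then show ?thesis
      using pairwiseD[OF rcos_disjoint[OF subgroup_H] C(1) D(1)] C(2) D(2) by (auto simp: disjnt_def)
  qed
  show ?thesis
    by (rule that[OF sub finite_subset[OF sub finite_carrier] card cover unique])
qed

text \<open>
The module \<open>\<ell>(G)\<close> is a direct sum of \<open>d\<close> copies of the convolution algebra \<open>A\<close>, one for each coset of \<open>H\<close>.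
Therefore \<open>dim (b * \<ell>(G)) = d dim (b * A)\<close>. The basis \<open>B\<close> of \<open>b * A\<close> consists of translates of \<open>b\<close>; the dimension of
\<open>b * \<ell>(G)\<close> is expressed by the size of a spanning set \<open>Y\<close> and by a lower bound for all spanning sets.
\<close>

lemma ideal_basis:
  fixes b :: "'a \<Rightarrow> 'k::real_or_complex"
  assumes b: "b \<in> supported"
  obtains B Y where "finite B" "fun_space.independent B" "B \<subseteq> (\<lambda>h. translation G h b) ` H"
    "\<And>h. h \<in> H \<Longrightarrow> translation G h b \<in> fun_space.span B"
    "finite Y" "card Y \<le> card (rcosets H) * card B" "\<And>v. v \<in> ell G \<Longrightarrow> act b v \<in> fun_space.span Y"
    "\<And>Z. finite Z \<Longrightarrow> act b ` ell G \<subseteq> fun_space.span Z \<Longrightarrow> card (rcosets H) * card B \<le> card Z"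
proof -
  obtain B where B: "B \<subseteq> (\<lambda>h. translation G h b) ` H" "fun_space.independent B"
      "(\<lambda>h. translation G h b) ` H \<subseteq> fun_space.span B"
    using fun_space.maximal_independent_subset by blast
  have fB: "finite B"
    using finite_subset[OF B(1)] by simp
  obtain R where R: "R \<subseteq> carrier G" "finite R" "card R = card (rcosets H)"
    "\<And>x. x \<in> carrier G \<Longrightarrow> \<exists>h\<in>H. \<exists>r\<in>R. x = h \<otimes> r"
    "\<And>r r' h. r \<in> R \<Longrightarrow> r' \<in> R \<Longrightarrow> h \<in> H \<Longrightarrow> h \<otimes> r \<otimes> inv r' \<in> H \<Longrightarrow> r = r'"
    using coset_representatives by blast
  define y where "y = (\<lambda>(r, \<beta>). translation G r \<beta> :: 'a \<Rightarrow> 'k)"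
  have sup: "\<beta> \<in> supported" if "\<beta> \<in> B" for \<beta>
    using that B(1) translation_supported[OF _ b] by blast
  have basis_in_image: "y (r, \<beta>) \<in> act b ` ell G" if r: "r \<in> R" and \<beta>: "\<beta> \<in> B" for r \<beta>
  proof -
    obtain h where h: "h \<in> H" "\<beta> = translation G h b"
      using \<beta> B(1) by blast
    have "y (r, \<beta>) = act b (translation G r (translation G h (delta \<one>)))"
      using r R(1) h by (auto simp: y_def act_translation act_delta_one[OF b])
    then show ?thesis
      by simp
  qed
  have image_in_span: "act b v \<in> fun_space.span (y ` (R \<times> B))" if v: "v \<in> ell G" for v
  proof -
    have "act b (delta x) \<in> fun_space.span (y ` (R \<times> B))" if x: "x \<in> carrier G" for x
    proof -
      obtain h r where hr: "h \<in> H" "r \<in> R" "x = h \<otimes> r"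
        using R(4)[OF x] by blast
      then have rc: "r \<in> carrier G"
        using R(1) by blast
      have eq: "z \<otimes> inv x = \<one> \<longleftrightarrow> z = x" if "z \<in> carrier G" for z
        using that \<open>x \<in> carrier G\<close> by (metis inv_equality inv_inv inv_closed r_inv)
      have "delta x = (translation G x (delta \<one>) :: 'a \<Rightarrow> 'k)"
        using \<open>x \<in> carrier G\<close> by (auto simp: fun_eq_iff delta_def translation_def eq)
      also have "\<dots> = translation G r (translation G h (delta \<one>))"
        using hr(1) rc by (simp add: translation_translation hr(3) m_comm)
      finally have "act b (delta x) = translation G r (translation G h b)"
        using rc hr(1) by (simp add: act_translation act_delta_one[OF b])
      moreover have "translation G r z \<in> fun_space.span (y ` (R \<times> B))" if "z \<in> fun_space.span B" for z
      proof -
        have "fun_space.subspace {z. translation G r z \<in> fun_space.span (y ` (R \<times> B))}"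
        proof (rule fun_space.subspaceI; clarsimp)
          show "translation G r 0 \<in> fun_space.span (y ` (R \<times> B))"
            using fun_space.span_zero by (simp add: translation_def zero_fun_def)
        next
          fix u w assume "translation G r u \<in> fun_space.span (y ` (R \<times> B))"
            "translation G r w \<in> fun_space.span (y ` (R \<times> B))"
          from fun_space.span_add[OF this] show "translation G r (u + w) \<in> fun_space.span (y ` (R \<times> B))"
            by (simp add: translation_def plus_fun_def if_distrib cong: if_cong)
        next
          fix c u assume "translation G r u \<in> fun_space.span (y ` (R \<times> B))"
          from fun_space.span_scale[OF this, of c]
          show "translation G r (\<lambda>g. c * u g) \<in> fun_space.span (y ` (R \<times> B))"
            by (simp add: translation_def if_distrib cong: if_cong)
        qed
        moreover have "translation G r \<beta> \<in> fun_space.span (y ` (R \<times> B))" if "\<beta> \<in> B" for \<beta>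
          using that hr(2) by (intro fun_space.span_base) (force simp: y_def)
        ultimately show ?thesis
          using fun_space.span_minimal[of B "{z. translation G r z \<in> fun_space.span (y ` (R \<times> B))}"] \<open>z \<in> _\<close> by blast
      qed
      ultimately show ?thesis
        using B(3) hr(1) by auto
    qed
    then have "(\<lambda>g. \<Sum>x\<in>carrier G. v x * act b (delta x) g) \<in> fun_space.span (y ` (R \<times> B))"
      by (rule span_sum_mem)
    also have "(\<lambda>g. \<Sum>x\<in>carrier G. v x * act b (delta x) g) = act b v"
      by (subst (2) ell_delta_sum[OF finite_carrier v]) (rule act_sum[symmetric])
    finally show ?thesis .
  qed
  have lower: "card (rcosets H) * card B \<le> card Z"
    if Z: "finite Z" "act b ` ell G \<subseteq> fun_space.span Z" for Z
  proof (rule ccontr)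
    assume "\<not> card (rcosets H) * card B \<le> card Z"
    then have less: "card Z < card (R \<times> B)"
      by (simp add: R(3) card_cartesian_product)
    have img: "y ` (R \<times> B) \<subseteq> fun_space.span Z"
    proof (rule image_subsetI)
      fix i assume "i \<in> R \<times> B"
      then show "y i \<in> fun_space.span Z"
        using subsetD[OF Z(2) basis_in_image] by (cases i) simp
    qed
    obtain k where k: "\<exists>i\<in>R \<times> B. k i \<noteq> 0" "\<And>g. (\<Sum>i\<in>R \<times> B. k i * y i g) = 0"
      using family_dependent[OF finite_cartesian_product[OF R(2) fB] Z(1) img less] by blast
    have "k (r, \<beta>) = 0" if r: "r \<in> R" and \<beta>: "\<beta> \<in> B" for r \<beta>
    proof (rule independent_relation[OF fB B(2) _ \<beta>, where k = "\<lambda>\<beta>. k (r, \<beta>)"])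
      fix h
      show "(\<Sum>\<beta>\<in>B. k (r, \<beta>) * \<beta> h) = 0"
      proof (cases "h \<in> H")
        case True
        \<comment> \<open>The translates of \<open>B\<close> by different representatives live on different cosets.\<close>
        have rc: "r \<in> carrier G" "h \<in> carrier G"
          using r R(1) True by auto
        have "0 = (\<Sum>r'\<in>R. \<Sum>\<beta>\<in>B. k (r', \<beta>) * y (r', \<beta>) (h \<otimes> r))"
          using k(2)[of "h \<otimes> r"] by (simp add: sum.cartesian_product case_prod_beta)
        also have "\<dots> = (\<Sum>r'\<in>R. if r' = r then (\<Sum>\<beta>\<in>B. k (r, \<beta>) * \<beta> h) else 0)"
        proof (intro sum.cong refl)
          fix r' assume r': "r' \<in> R"
          show "(\<Sum>\<beta>\<in>B. k (r', \<beta>) * y (r', \<beta>) (h \<otimes> r))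
              = (if r' = r then (\<Sum>\<beta>\<in>B. k (r, \<beta>) * \<beta> h) else 0)"
          proof (cases "r' = r")
            case True
            then show ?thesis
              using rc by (simp add: y_def translation_def)
          next
            case False
            then have "h \<otimes> r \<otimes> inv r' \<notin> H"
              using R(5)[OF r r' \<open>h \<in> H\<close>] by blast
            then show ?thesis
              using False sup by (auto simp: y_def translation_def supported_def intro!: sum.neutral)
          qed
        qed
        also have "\<dots> = (\<Sum>\<beta>\<in>B. k (r, \<beta>) * \<beta> h)"
          using R(2) r by simp
        finally show ?thesis by simp
      next
        case False
        then show ?thesis
          using sup by (auto simp: supported_def intro!: sum.neutral)
      qed
    qed
    then show False
      using k(1) by auto
  qed
  have "card (y ` (R \<times> B)) \<le> card (rcosets H) * card B"
    using card_image_le[of "R \<times> B" y] R(2,3) fB by (simp add: card_cartesian_product)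
  then show ?thesis
    using that[OF fB B(2) B(1) _ _ _ image_in_span lower] B(3) R(2) fB by blast
qed

text \<open>
Let \<open>c\<close> be the autocorrelation of \<open>e\<close>. The module \<open>c * \<ell>(G)\<close> has dimension \<open>d dim (c * A)\<close>. Suppose there are
\<open>d\<close> or more generators. The elements \<open>\<beta> * f m\<close>, with \<open>\<beta>\<close> in a basis of \<open>c * A\<close>, are then at least that many,
and \<open>c * e\<close>, which is nonzero and orthogonal to all of them, is one more. So they satisfy a nontrivial relation, and
\<open>c * e\<close> does not take part in it. The resulting coefficients \<open>b m\<close> lie in the ideal \<open>c * A\<close>. On that ideal
\<open>b\<^sup>* * e = 0\<close> implies \<open>b = 0\<close>, because convolution of \<open>c\<close> by \<open>x\<close> lists the inner products of \<open>x * e\<close>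
with the translates of \<open>e\<close>. This contradicts the hypothesis on relations.
\<close>

lemma card_generators_less:
  fixes e :: "'a \<Rightarrow> 'k::real_or_complex" and f :: "'i \<Rightarrow> 'a \<Rightarrow> 'k"
  assumes K: "finite K"
    and e: "e \<in> ell G" "e \<noteq> 0"
    and orth: "\<And>m h. m \<in> K \<Longrightarrow> h \<in> H \<Longrightarrow> ell_inner G (translation G h (f m)) e = 0"
    and rel: "\<And>b. \<lbrakk>\<And>m. m \<in> K \<Longrightarrow> b m \<in> supported; \<And>g. (\<Sum>m\<in>K. act (b m) (f m) g) = 0\<rbrakk>
      \<Longrightarrow> \<forall>m\<in>K. act (star (b m)) e = 0"
  shows "card K < card (rcosets H)"
proof (rule ccontr)
  assume "\<not> card K < card (rcosets H)"
  then have le: "card (rcosets H) \<le> card K" by simp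
  define c where "c = (\<lambda>h. if h \<in> H then ell_inner G e (translation G h e) else 0)"
  have c: "c \<in> supported"
    unfolding c_def supported_def by simp
  have act_c: "act x c h = ell_inner G (act x e) (translation G h e)" if "h \<in> H" for x h
  proof -
    have "ell_inner G (translation G k e) (translation G h e) = translation G k c h" if "k \<in> H" for k
    proof -
      have "translation G h e = translation G k (translation G (h \<otimes> inv k) e)"
        using that \<open>h \<in> H\<close> by (simp add: translation_translation m_comm[of h])
      then have "ell_inner G (translation G k e) (translation G h e) = c (h \<otimes> inv k)"
        using that \<open>h \<in> H\<close> inner_translation_translation[of k e "translation G (h \<otimes> inv k) e"]
        by (simp add: c_def)
      then show ?thesis
        using \<open>h \<in> H\<close> by (simp add: translation_def)
    qed
    then show ?thesis
      unfolding act_def by (simp add: ell_inner_sum_left)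
  qed
  \<comment> \<open>The autocorrelation is Hermitian, so vanishing of \<open>c * c\<close> would already give \<open>c = 0\<close>.\<close>
  have star_c: "star c = c"
  proof
    fix h
    show "star c h = c h"
      using inner_translation_adjoint[of "inv h" e e] ell_inner_commute[of G e "translation G (inv h) e"]
      by (simp add: star_def c_def)
  qed
  have ce: "act c e \<noteq> 0"
  proof
    assume "act c e = 0"
    then have "act c c h = 0" if "h \<in> H" for h
      using act_c[OF that, of c] by (simp add: ell_inner_lin_left)
    moreover have "act c c h = 0" if "h \<notin> H" for h
      using translation_supported[OF _ c] that unfolding act_def supported_def by simp
    ultimately have "act (star c) c = 0"
      unfolding star_c by (metis zero_fun_def ext)
    then have "c = 0"
      by (rule eq_0_if_star_act_eq_0[OF c])
    then have "c \<one> = 0"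
      by simp
    then have "ell_inner G e e = 0"
      by (simp add: c_def translation_one[OF e(1)])
    then show False
      using ell_inner_self_eq_0[OF finite_carrier e(1)] e(2) by blast
  qed
  obtain B Y where B: "finite B" "fun_space.independent B" "B \<subseteq> (\<lambda>h. translation G h c) ` H"
    and Y: "finite Y" "card Y \<le> card (rcosets H) * card B" "\<And>v. v \<in> ell G \<Longrightarrow> act c v \<in> fun_space.span Y"
    using ideal_basis[OF c] by metis
  have BE: "\<exists>h\<in>H. \<beta> = translation G h c" if "\<beta> \<in> B" for \<beta>
    using that B(3) by blast
  let ?I = "insert None (Some ` (B \<times> K))"
  define x where "x i = (case i of None \<Rightarrow> act c e | Some (\<beta>, m) \<Rightarrow> act \<beta> (f m))" for i
  have finI: "finite ?I"
    using B(1) K by simp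
  have "x i \<in> fun_space.span Y" if "i \<in> ?I" for i
    using that BE Y(3) e(1) by (force simp: x_def act_translation_left)
  then have img: "x ` ?I \<subseteq> fun_space.span Y"
    by (rule image_subsetI)
  have less: "card Y < card ?I"
  proof -
    have "card ?I = Suc (card B * card K)"
      using B(1) K by (simp add: card_image card_cartesian_product)
    moreover have "card Y \<le> card K * card B"
      using Y(2) mult_le_mono1[OF le] by (rule order_trans)
    ultimately show ?thesis
      by (simp add: mult.commute)
  qed
  obtain k where k: "\<exists>i\<in>?I. k i \<noteq> 0" "\<And>g. (\<Sum>i\<in>?I. k i * x i g) = 0"
    using family_dependent[OF finI Y(1) img less] by blast
  \<comment> \<open>The index \<open>None\<close> stands for the additional vector \<open>c * e\<close>.\<close>
  have split: "k None * act c e g + (\<Sum>q\<in>B \<times> K. k (Some q) * act (fst q) (f (snd q)) g) = 0" for g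
    using k(2)[of g] B(1) K by (simp add: x_def sum.reindex case_prod_beta)
  have orth_act: "ell_inner G (act \<beta> (f m)) (act c e) = 0" if "m \<in> K" for \<beta> m
  proof -
    have "ell_inner G (translation G h (f m)) (act c e) = 0" if h: "h \<in> H" for h
    proof -
      have "ell_inner G (translation G h (f m)) (translation G h' e) = 0" if h': "h' \<in> H" for h'
      proof -
        have "ell_inner G (translation G h (f m)) (translation G h' e)
            = ell_inner G (translation G (inv h') (translation G h (f m))) e"
          using h' inner_translation_adjoint[of "inv h'" "translation G h (f m)" e] by simp
        then show ?thesis
          using h h' orth[OF \<open>m \<in> K\<close>] by (simp add: translation_translation)
      qed
      then show ?thesis
        unfolding act_def[of c] by (simp add: ell_inner_sum_right)
    qed
    then show ?thesis
      unfolding act_def[of \<beta>] by (simp add: ell_inner_sum_left)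
  qed
  have "k None * ell_inner G (act c e) (act c e)
      = ell_inner G (\<lambda>g. k None * act c e g + (\<Sum>q\<in>B \<times> K. k (Some q) * act (fst q) (f (snd q)) g)) (act c e)"
    by (auto simp: ell_inner_lin_left ell_inner_sum_left orth_act intro!: sum.neutral)
  also have "\<dots> = 0"
    by (simp only: split ell_inner_lin_left)
  finally have kN: "k None = 0"
    using ell_inner_self_eq_0[OF finite_carrier act_in_ell] ce by auto
  define b where "b m = (\<lambda>g. \<Sum>\<beta>\<in>B. k (Some (\<beta>, m)) * \<beta> g)" for m
  have b_sup: "b m \<in> supported" for m
    unfolding b_def using BE translation_supported[OF _ c] by (intro supported_sum) blast
  have "(\<Sum>m\<in>K. act (b m) (f m) g) = 0" for g
  proof -
    have "(\<Sum>m\<in>K. act (b m) (f m) g) = (\<Sum>\<beta>\<in>B. \<Sum>m\<in>K. k (Some (\<beta>, m)) * act \<beta> (f m) g)"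
      unfolding b_def act_sum_left by (rule sum.swap)
    then show ?thesis
      using split[of g] kN by (simp add: sum.cartesian_product case_prod_beta)
  qed
  then have be: "act (star (b m)) e = 0" if "m \<in> K" for m
    using rel[of b] b_sup that by blast
  have b0: "b m = 0" if m: "m \<in> K" for m
  proof (rule eq_0_if_star_act_eq_0[OF b_sup])
    have "act (star (b m)) c h = 0" for h
    proof (cases "h \<in> H")
      case True
      then show ?thesis
        using act_c[OF True, of "star (b m)"] be[OF m] by (simp add: ell_inner_lin_left)
    next
      case False
      then show ?thesis
        using translation_supported[OF _ c] unfolding act_def supported_def by simp
    qed
    then have "act (star (b m)) c = 0" by auto
    then have "act (star (b m)) \<beta> = 0" if "\<beta> \<in> B" for \<beta>
      using BE[OF that] by (auto simp: act_translation) (simp add: translation_def zero_fun_def)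
    then show "act (star (b m)) (b m) = 0"
      unfolding b_def[of m] act_sum by (auto simp: b_def[of m, symmetric])
  qed
  have "k (Some (\<beta>, m)) = 0" if "\<beta> \<in> B" "m \<in> K" for \<beta> m
    using independent_relation[OF B(1,2) _ that(1), of "\<lambda>\<beta>. k (Some (\<beta>, m))"] fun_cong[OF b0[OF that(2)]]
    by (simp add: b_def)
  then show False
    using k(1) kN by auto
qed

text \<open>
If \<open>b\<close> kills a complement of the submodule generated by the \<open>f m\<close>, then \<open>b * \<ell>(G)\<close>, of dimension
\<open>d dim (b * A)\<close>, is spanned by the \<open>\<beta> * f m\<close> with \<open>\<beta>\<close> in a basis of \<open>b * A\<close>, which are fewer unless \<open>b = 0\<close>.
\<close>

lemma annihilator_of_corank_eq_0:
  fixes b :: "'a \<Rightarrow> 'k::real_or_complex" and f :: "'i \<Rightarrow> 'a \<Rightarrow> 'k"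
  assumes K: "finite K" "card K < card (rcosets H)"
    and b: "b \<in> supported"
    and dec: "\<And>v. v \<in> ell G \<Longrightarrow> \<exists>w u. v = w + u
      \<and> w \<in> fun_space.span ((\<lambda>(h, m). translation G h (f m)) ` (H \<times> K)) \<and> act b u = 0"
  shows "b = 0"
proof (rule ccontr)
  assume "b \<noteq> 0"
  obtain B where B: "finite B" "fun_space.independent B" "B \<subseteq> (\<lambda>h. translation G h b) ` H"
    and Bspan: "\<And>h. h \<in> H \<Longrightarrow> translation G h b \<in> fun_space.span B"
    and lower: "\<And>Z. finite Z \<Longrightarrow> act b ` ell G \<subseteq> fun_space.span Z \<Longrightarrow> card (rcosets H) * card B \<le> card Z"
    using ideal_basis[OF b] by metis
  let ?Z = "(\<lambda>(\<beta>, m). act \<beta> (f m)) ` (B \<times> K)"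
  have "B \<noteq> {}"
    using Bspan[of \<one>] \<open>b \<noteq> 0\<close> by (auto simp: translation_one supported_subset_ell[OF b])
  have gen: "act b (translation G h (f m)) \<in> fun_space.span ?Z" if "h \<in> H" "m \<in> K" for h m
  proof -
    have "fun_space.subspace {x. act x (f m) \<in> fun_space.span ?Z}"
    proof (rule fun_space.subspaceI; clarsimp)
      show "act 0 (f m) \<in> fun_space.span ?Z"
        using fun_space.span_zero by (simp add: act_def zero_fun_def)
    next
      fix u w assume "act u (f m) \<in> fun_space.span ?Z" "act w (f m) \<in> fun_space.span ?Z"
      from fun_space.span_add[OF this] show "act (u + w) (f m) \<in> fun_space.span ?Z"
        by (simp add: act_def plus_fun_def distrib_right sum.distrib)
    next
      fix c u assume "act u (f m) \<in> fun_space.span ?Z"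
      from fun_space.span_scale[OF this, of c] show "act (\<lambda>g. c * u g) (f m) \<in> fun_space.span ?Z"
        by (simp add: act_def sum_distrib_left mult.assoc)
    qed
    moreover have "B \<subseteq> {x. act x (f m) \<in> fun_space.span ?Z}"
      using that(2) by (auto intro!: fun_space.span_base)
    ultimately have "act (translation G h b) (f m) \<in> fun_space.span ?Z"
      using fun_space.span_minimal Bspan[OF that(1)] by blast
    then show ?thesis
      using that(1) by (simp add: act_translation_left)
  qed
  have sub: "fun_space.subspace {w. act b w \<in> fun_space.span ?Z}"
  proof (rule fun_space.subspaceI; clarsimp)
    show "act b 0 \<in> fun_space.span ?Z"
      by (simp only: act_zero fun_space.span_zero)
  next
    fix u w assume "act b u \<in> fun_space.span ?Z" "act b w \<in> fun_space.span ?Z"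
    from fun_space.span_add[OF this] show "act b (u + w) \<in> fun_space.span ?Z"
      by (simp only: act_plus)
  next
    fix c u assume "act b u \<in> fun_space.span ?Z"
    from fun_space.span_scale[OF this, of c] show "act b (\<lambda>g. c * u g) \<in> fun_space.span ?Z"
      using act_sum[of b "\<lambda>_. c" "\<lambda>_. u" "{()}"] by simp
  qed
  have "act b v \<in> fun_space.span ?Z" if v: "v \<in> ell G" for v
  proof -
    obtain w u where wu: "v = w + u" "act b u = 0"
      "w \<in> fun_space.span ((\<lambda>(h, m). translation G h (f m)) ` (H \<times> K))"
      using dec[OF v] by blast
    have "(\<lambda>(h, m). translation G h (f m)) ` (H \<times> K) \<subseteq> {w. act b w \<in> fun_space.span ?Z}"
      using gen by auto
    from fun_space.span_minimal[OF this sub] have "w \<in> {w. act b w \<in> fun_space.span ?Z}"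
      using wu(3) by (rule subsetD)
    then show ?thesis
      by (simp add: wu act_plus)
  qed
  then have "card (rcosets H) * card B \<le> card ?Z"
    using B(1) K(1) by (intro lower) auto
  also have "\<dots> \<le> card B * card K"
    using card_image_le[of "B \<times> K" "\<lambda>(\<beta>, m). act \<beta> (f m)"] B(1) K(1) by (simp add: card_cartesian_product)
  finally show False
    using K(2) \<open>B \<noteq> {}\<close> B(1) by (simp add: mult.commute)
qed

end

section \<open>Stationarity of local minimizers\<close>

lemma conv_system_apply: "conv_system G u (h, m) = translation G h (u m)"
  unfolding conv_system_def by simp

context convolution_setting
begin

lemma frame_operator_translation:
  assumes "k \<in> H"
  shows "frame_operator G (H \<times> M) (conv_system G f) (translation G k v)
    = translation G k (frame_operator G (H \<times> M) (conv_system G f) v)"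
proof
  fix x
  have "frame_operator G (H \<times> M) (conv_system G f) (translation G k v) x
      = (\<Sum>h\<in>H. \<Sum>m\<in>M. ell_inner G (translation G k v) (translation G h (f m)) * translation G h (f m) x)"
    unfolding frame_operator_def conv_system_def by (simp add: sum.cartesian_product case_prod_beta)
  also have "\<dots> = (\<Sum>h\<in>H. \<Sum>m\<in>M. ell_inner G (translation G k v) (translation G (k \<otimes> h) (f m))
      * translation G (k \<otimes> h) (f m) x)"
    by (rule sum_shift_H[OF assms, symmetric])
  also have "\<dots> = (\<Sum>h\<in>H. \<Sum>m\<in>M. ell_inner G v (translation G h (f m)) * translation G k (translation G h (f m)) x)"
    using assms by (intro sum.cong refl)
      (simp add: translation_translation[symmetric] inner_translation_translation)
  also have "\<dots> = translation G k (frame_operator G (H \<times> M) (conv_system G f) v) x"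
    unfolding frame_operator_def conv_system_def translation_sum
    by (simp add: sum.cartesian_product case_prod_beta)
  finally show "frame_operator G (H \<times> M) (conv_system G f) (translation G k v) x
      = translation G k (frame_operator G (H \<times> M) (conv_system G f) v) x" .
qed

lemma frame_operator_act:
  "frame_operator G (H \<times> M) (conv_system G f) (act b v)
    = act b (frame_operator G (H \<times> M) (conv_system G f) v)"
  unfolding act_def frame_operator_sum by (simp add: frame_operator_translation)

lemma frame_operator_quadratic_translates:
  "(\<Sum>j\<in>H \<times> M. ell_inner G (frame_operator G (H \<times> N) (conv_system G f) (conv_system G u j)) (conv_system G v j))
    = of_nat (card H) * (\<Sum>m\<in>M. ell_inner G (frame_operator G (H \<times> N) (conv_system G f) (u m)) (v m))"
proof -
  have "(\<Sum>j\<in>H \<times> M. ell_inner G (frame_operator G (H \<times> N) (conv_system G f) (conv_system G u j)) (conv_system G v j))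
    = (\<Sum>j\<in>H \<times> M. ell_inner G (frame_operator G (H \<times> N) (conv_system G f) (u (snd j))) (v (snd j)))"
    unfolding conv_system_def[of G u] conv_system_def[of G v]
    by (intro sum.cong refl) (auto simp: frame_operator_translation inner_translation_translation)
  also have "\<dots> = (\<Sum>h\<in>H. \<Sum>m\<in>M. ell_inner G (frame_operator G (H \<times> N) (conv_system G f) (u m)) (v m))"
    unfolding sum.cartesian_product by (simp add: case_prod_beta)
  finally show ?thesis
    by simp
qed

text \<open>
Convolution can be moved from one factor of \<open>\<Sum>\<^sub>h T\<^sub>h u \<otimes> T\<^sub>h e\<close> to the other at the cost of the involution. Hence
a relation \<open>\<Sum> b\<^sub>m * f\<^sub>m = 0\<close> makes the mixed terms vanish for the perturbations \<open>b\<^sub>m\<^sup>* * e\<close> of the \<open>f\<^sub>m\<close>.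
\<close>

lemma cross_kernel_transfer:
  "(\<Sum>h\<in>H. translation G h u p * conjugate (translation G h (act (star b) e) q))
    = (\<Sum>h\<in>H. translation G h (act b u) p * conjugate (translation G h e q))"
proof -
  have "translation G h (act (star b) e) q = (\<Sum>k\<in>H. conjugate (b k) * translation G (inv k \<otimes> h) e q)"
    if "h \<in> H" for h
  proof -
    have "translation G h (act (star b) e) q = act (star b) (translation G h e) q"
      using that by (simp add: act_translation)
    also have "\<dots> = (\<Sum>k\<in>H. conjugate (b (inv k)) * translation G (inv (inv k) \<otimes> h) e q)"
      using that unfolding act_def star_def by (simp add: translation_translation)
    also have "\<dots> = (\<Sum>k\<in>H. conjugate (b k) * translation G (inv k \<otimes> h) e q)"
      by (rule sum_inv_H)
    finally show ?thesis .
  qed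
  then have "(\<Sum>h\<in>H. translation G h u p * conjugate (translation G h (act (star b) e) q))
      = (\<Sum>h\<in>H. \<Sum>k\<in>H. b k * (translation G h u p * conjugate (translation G (inv k \<otimes> h) e q)))"
    by (simp add: conjugate_sum conjugate_mult sum_distrib_left mult.left_commute)
  also have "\<dots> = (\<Sum>k\<in>H. \<Sum>h\<in>H. b k * (translation G h u p * conjugate (translation G (inv k \<otimes> h) e q)))"
    by (rule sum.swap)
  also have "\<dots> = (\<Sum>k\<in>H. \<Sum>h\<in>H. b k * (translation G (k \<otimes> h) u p * conjugate (translation G h e q)))"
  proof (rule sum.cong[OF refl])
    fix k assume "k \<in> H"
    then show "(\<Sum>h\<in>H. b k * (translation G h u p * conjugate (translation G (inv k \<otimes> h) e q)))
        = (\<Sum>h\<in>H. b k * (translation G (k \<otimes> h) u p * conjugate (translation G h e q)))"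
      by (subst sum_shift_H[of k, symmetric]) simp_all
  qed
  also have "\<dots> = (\<Sum>h\<in>H. \<Sum>k\<in>H. b k * (translation G (k \<otimes> h) u p * conjugate (translation G h e q)))"
    by (rule sum.swap)
  also have "\<dots> = (\<Sum>h\<in>H. act b (translation G h u) p * conjugate (translation G h e q))"
    unfolding act_def by (simp add: sum_distrib_right translation_translation mult.assoc)
  also have "\<dots> = (\<Sum>h\<in>H. translation G h (act b u) p * conjugate (translation G h e q))"
    by (simp add: act_translation)
  finally show ?thesis .
qed

end

locale frame_potential_minimizer = convolution_setting G H for G (structure) and H +
  fixes n :: nat and a :: "nat \<Rightarrow> real" and f :: "nat \<Rightarrow> 'a \<Rightarrow> 'k::real_or_complex"
  assumes a_pos: "m < n \<Longrightarrow> a m > 0" and minimizer: "local_minimizer_FP G H n a f"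
begin

abbreviation S :: "('a \<Rightarrow> 'k) \<Rightarrow> 'a \<Rightarrow> 'k" where
  "S \<equiv> frame_operator G (H \<times> {..<n}) (conv_system G f)"

lemma f_in_ell: "m < n \<Longrightarrow> f m \<in> ell G"
  and norm_f: "m < n \<Longrightarrow> ell_norm G (f m) = a m"
  using minimizer unfolding local_minimizer_FP_def norm_constraint_set_def by auto

lemma inner_f_self: "m < n \<Longrightarrow> ell_inner G (f m) (f m) = of_real ((a m)\<^sup>2)"
  by (simp only: ell_inner_self_norm norm_f)

lemma eventually_FP_le_perturbation:
  assumes y: "\<And>m. m < n \<Longrightarrow> y m \<in> ell G" and orth: "\<And>m. m < n \<Longrightarrow> ell_inner G (f m) (y m) = 0"
  shows "eventually (\<lambda>t. frame_potential G (H \<times> {..<n}) (conv_system G f)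
      \<le> frame_potential G (H \<times> {..<n}) (rescaled_perturbation (\<lambda>j. (ell_norm G (y (snd j)) / a (snd j))\<^sup>2)
          (conv_system G f) (conv_system G y) t)) (at_right 0)"
proof -
  define \<gamma> where "\<gamma> m = (ell_norm G (y m) / a m)\<^sup>2" for m
  define u where "u t = rescaled_perturbation \<gamma> f y t" for t
  have conv: "conv_system G (u t) = rescaled_perturbation (\<lambda>j. (ell_norm G (y (snd j)) / a (snd j))\<^sup>2)
      (conv_system G f) (conv_system G y) t" for t
    unfolding u_def rescaled_perturbation_def conv_system_def translation_def \<gamma>_def
    by (auto simp: fun_eq_iff)
  have constraint: "u t \<in> norm_constraint_set G n a" for t
  proof -
    have "ell_norm G (u t m) = a m" if m: "m < n" for m
    proof (rule power2_eq_imp_eq)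
      have pos: "1 + t\<^sup>2 * \<gamma> m > 0"
        by (simp add: \<gamma>_def add_pos_nonneg)
      have yf: "ell_inner G (y m) (f m) = 0"
        using orth[OF m] ell_inner_commute[of G "y m" "f m"] by (simp add: conjugate_0)
      have "of_real ((ell_norm G (\<lambda>g. f m g + of_real t * y m g))\<^sup>2) = (of_real ((a m)\<^sup>2 + t\<^sup>2 * (ell_norm G (y m))\<^sup>2) :: 'k)"
        unfolding ell_inner_self_norm[symmetric] ell_inner_lin_left ell_inner_lin_right
        by (simp add: orth[OF m] yf norm_f[OF m] ell_inner_self_norm conjugate_of_real power2_eq_square)
      then have sq: "(ell_norm G (\<lambda>g. f m g + of_real t * y m g))\<^sup>2 = (a m)\<^sup>2 + t\<^sup>2 * (ell_norm G (y m))\<^sup>2"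
        by (simp only: of_real_eq_iff)
      have "(ell_norm G (u t m))\<^sup>2 = ((a m)\<^sup>2 + t\<^sup>2 * (ell_norm G (y m))\<^sup>2) / (1 + t\<^sup>2 * \<gamma> m)"
        using pos unfolding u_def rescaled_perturbation_def ell_norm_scale power_mult_distrib sq norm_of_real
        by (simp add: power_divide)
      also have "\<dots> = (a m)\<^sup>2"
        using pos a_pos[OF m] by (simp add: divide_eq_eq \<gamma>_def field_simps)
      finally show "(ell_norm G (u t m))\<^sup>2 = (a m)\<^sup>2" .
    qed (use a_pos[OF m] in auto)
    moreover have "u t m \<in> ell G" if "m < n" for m
      using y[OF that] f_in_ell[OF that] unfolding u_def rescaled_perturbation_def by (intro ell_lin)
    ultimately show ?thesis
      unfolding norm_constraint_set_def by blast
  qed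
  obtain \<epsilon> where \<epsilon>: "\<epsilon> > 0" "\<And>u. u \<in> norm_constraint_set G n a \<Longrightarrow> (\<forall>m<n. ell_norm G (u m - f m) < \<epsilon>) \<Longrightarrow>
        frame_potential G (H \<times> {..<n}) (conv_system G f) \<le> frame_potential G (H \<times> {..<n}) (conv_system G u)"
    using minimizer unfolding local_minimizer_FP_def by blast
  have "eventually (\<lambda>t. ell_norm G (u t m - f m) < \<epsilon>) (at_right 0)" for m
  proof -
    have "((\<lambda>t. u t m g) \<longlongrightarrow> of_real (1 / sqrt (1 + 0\<^sup>2 * \<gamma> m)) * (f m g + of_real 0 * y m g)) (at_right 0)" for g
      unfolding u_def rescaled_perturbation_def by (intro tendsto_intros) auto
    then have "((\<lambda>t. u t m g - f m g) \<longlongrightarrow> 0) (at_right 0)" for g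
      by (simp add: LIM_zero)
    then have "((\<lambda>t. sqrt (\<Sum>g\<in>carrier G. (norm (u t m g - f m g))\<^sup>2)) \<longlongrightarrow> sqrt (\<Sum>g\<in>carrier G. (norm (0::'k))\<^sup>2)) (at_right 0)"
      by (intro tendsto_intros)
    then have "((\<lambda>t. ell_norm G (u t m - f m)) \<longlongrightarrow> 0) (at_right 0)"
      by (simp add: ell_norm_def ell_inner_self sum_nonneg del: of_real_sum)
    then show ?thesis
      using \<epsilon>(1) by (rule order_tendstoD)
  qed
  then have "eventually (\<lambda>t. \<forall>m\<in>{..<n}. ell_norm G (u t m - f m) < \<epsilon>) (at_right 0)"
    by (intro eventually_ball_finite) auto
  then show ?thesis
    unfolding conv[symmetric] by eventually_elim (use \<epsilon>(2) constraint in auto)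
qed

text \<open>
The Rayleigh quotient of the frame operator at \<open>f m\<close>; it is an eigenvalue by \<open>S_f\<close>.
\<close>

definition eigenvalue :: "nat \<Rightarrow> real" where
  "eigenvalue m = (\<Sum>j\<in>H \<times> {..<n}. (norm (ell_inner G (f m) (conv_system G f j)))\<^sup>2) / (a m)\<^sup>2"

text \<open>
The component of \<open>S (f m)\<close> orthogonal to \<open>f m\<close> is a tangent direction of the constraint and, up to sign, the
gradient of the frame potential along it.
\<close>

lemma S_f:
  assumes m: "m < n"
  shows "S (f m) = (\<lambda>g. of_real (eigenvalue m) * f m g)"
proof -
  define z where "z = (\<lambda>g. of_real (eigenvalue m) * f m g - S (f m) g)"
  have S_ell: "S v \<in> ell G" for v
    by (rule frame_operator_in_ell) (auto simp: conv_system_def)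
  have z_ell: "z \<in> ell G"
    unfolding z_def by (intro ell_lin f_in_ell[OF m] S_ell)
  have "ell_inner G (S (f m)) (f m) = of_real (eigenvalue m * (a m)\<^sup>2)"
    using a_pos[OF m] unfolding frame_operator_quadratic_form eigenvalue_def by simp
  then have fz: "ell_inner G (f m) z = 0"
    unfolding z_def ell_inner_lin_right
    by (simp add: inner_f_self[OF m] conjugate_of_real flip: frame_operator_self_adjoint)
  have "S (f m) = (\<lambda>g. of_real (eigenvalue m) * f m g - z g)"
    unfolding z_def by simp
  then have Sfz: "ell_inner G (S (f m)) z = of_real (- ((ell_norm G z)\<^sup>2))"
    by (simp add: ell_inner_lin_left fz ell_inner_self_norm)
  have Szf: "ell_inner G (S z) (f m) = of_real (- ((ell_norm G z)\<^sup>2))"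
    unfolding frame_operator_self_adjoint by (subst ell_inner_commute) (simp only: Sfz conjugate_of_real)
  define y where "y i = (if i = m then z else 0)" for i
  have "0 \<le> - 2 * real (card H) * (ell_norm G z)\<^sup>2"
  proof (rule first_variation[where J = "H \<times> {..<n}" and G = G and x = "conv_system G f" and y = "conv_system G y"
        and \<gamma> = "\<lambda>j. (ell_norm G (y (snd j)) / a (snd j))\<^sup>2"])
    show "eventually (\<lambda>t. frame_potential G (H \<times> {..<n}) (conv_system G f)
      \<le> frame_potential G (H \<times> {..<n}) (rescaled_perturbation (\<lambda>j. (ell_norm G (y (snd j)) / a (snd j))\<^sup>2)
          (conv_system G f) (conv_system G y) t)) (at_right 0)"
      by (rule eventually_FP_le_perturbation) (auto simp: y_def z_ell ell_lin(5) fz ell_inner_lin_right)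
    have "(\<Sum>i<n. ell_inner G (S (y i)) (f i)) = (\<Sum>i<n. if i = m then of_real (- ((ell_norm G z)\<^sup>2)) else 0)"
      by (intro sum.cong refl) (auto simp: y_def Szf frame_operator_zero ell_inner_lin_left)
    moreover have "(\<Sum>i<n. ell_inner G (S (f i)) (y i)) = (\<Sum>i<n. if i = m then of_real (- ((ell_norm G z)\<^sup>2)) else 0)"
      by (intro sum.cong refl) (auto simp: y_def Sfz ell_inner_lin_right)
    ultimately show "of_real (- 2 * real (card H) * (ell_norm G z)\<^sup>2)
        = (\<Sum>j\<in>H \<times> {..<n}. ell_inner G (S (conv_system G y j)) (conv_system G f j)
            + ell_inner G (S (conv_system G f j)) (conv_system G y j))"
      unfolding sum.distrib frame_operator_quadratic_translates using m by simp
  qed auto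
  moreover have "card H > 0"
    using card_gt_0_iff H_closed(4) finite_H by blast
  ultimately have "(ell_norm G z)\<^sup>2 = 0"
    by (auto simp: mult_le_0_iff)
  then have "z = 0"
    using ell_inner_self_eq_0[OF finite_carrier z_ell] by (simp add: ell_inner_self_norm)
  then show ?thesis
    unfolding z_def by (auto simp: fun_eq_iff)
qed

text \<open>
The second variation in the directions \<open>b\<^sub>m\<^sup>* * e\<close>. They are eigenvectors for \<open>\<mu>\<close>, hence orthogonal to the \<open>f m\<close>, whose
eigenvalues are larger. Each nonzero direction would decrease the frame potential, since it moves weight from the
eigenvalue of \<open>f m\<close> to the smaller eigenvalue \<open>\<mu>\<close>.
\<close>

lemma annihilation_from_relation:
  assumes e: "e \<in> ell G" "S e = (\<lambda>g. of_real \<mu> * e g)"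
    and K: "K = {m. m < n \<and> eigenvalue m > \<mu>}"
    and rel: "\<And>g. (\<Sum>m\<in>K. act (b m) (f m) g) = 0"
  shows "\<forall>m\<in>K. act (star (b m)) e = 0"
proof -
  define y where "y m = (if m \<in> K then act (star (b m)) e else 0)" for m
  have y_ell: "y m \<in> ell G" for m
    by (simp add: y_def ell_lin(5))
  have Sy: "S (y m) = (\<lambda>g. of_real \<mu> * y m g)" for m
  proof -
    have "S (act (star (b m)) e) = act (star (b m)) (\<lambda>g. of_real \<mu> * e g)"
      by (simp only: frame_operator_act e)
    also have "\<dots> = (\<lambda>g. of_real \<mu> * act (star (b m)) e g)"
      using act_sum[of "star (b m)" "\<lambda>_. of_real \<mu>" "\<lambda>_. e" "{()}"] by simp
    finally show ?thesis
      by (simp add: y_def frame_operator_zero) (simp add: zero_fun_def)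
  qed
  have orth: "ell_inner G (f m) (y m) = 0" if "m < n" for m
  proof (cases "m \<in> K")
    case True
    then show ?thesis
      using eigenvectors_orthogonal[OF S_f[OF that] Sy[of m]] K by auto
  qed (simp add: y_def ell_inner_lin_right)
  have half: "(\<Sum>j\<in>H \<times> {..<n}. conv_system G f j p * conjugate (conv_system G y j q)) = 0" for p q
  proof -
    have "(\<Sum>j\<in>H \<times> {..<n}. conv_system G f j p * conjugate (conv_system G y j q))
        = (\<Sum>m<n. \<Sum>h\<in>H. translation G h (f m) p * conjugate (translation G h (y m) q))"
      unfolding conv_system_def by (subst sum.swap) (simp add: sum.cartesian_product case_prod_beta)
    also have "\<dots> = (\<Sum>m\<in>K. \<Sum>h\<in>H. translation G h (f m) p * conjugate (translation G h (act (star (b m)) e) q))"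
      using K by (intro sum.mono_neutral_cong_right) (auto simp: y_def translation_def conjugate_0 zero_fun_def)
    also have "\<dots> = (\<Sum>h\<in>H. \<Sum>m\<in>K. translation G h (act (b m) (f m)) p * conjugate (translation G h e q))"
      unfolding cross_kernel_transfer by (rule sum.swap)
    also have "\<dots> = (\<Sum>h\<in>H. translation G h (\<lambda>g. \<Sum>m\<in>K. 1 * act (b m) (f m) g) p * conjugate (translation G h e q))"
      unfolding translation_sum by (simp add: sum_distrib_right)
    also have "\<dots> = 0"
      by (simp add: rel translation_def)
    finally show ?thesis .
  qed
  define c where "c = real (card H) * (\<Sum>m\<in>K. (\<mu> - eigenvalue m) * (ell_norm G (y m))\<^sup>2)"
  have "0 \<le> c"
  proof (rule second_variation[where J = "H \<times> {..<n}" and G = G and x = "conv_system G f" and y = "conv_system G y"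
        and \<gamma> = "\<lambda>j. (ell_norm G (y (snd j)) / a (snd j))\<^sup>2"])
    show "eventually (\<lambda>t. frame_potential G (H \<times> {..<n}) (conv_system G f)
      \<le> frame_potential G (H \<times> {..<n}) (rescaled_perturbation (\<lambda>j. (ell_norm G (y (snd j)) / a (snd j))\<^sup>2)
          (conv_system G f) (conv_system G y) t)) (at_right 0)"
      by (rule eventually_FP_le_perturbation[OF y_ell orth])
    show "(\<Sum>j\<in>H \<times> {..<n}. conv_system G f j p * conjugate (conv_system G y j q)
        + conv_system G y j p * conjugate (conv_system G f j q)) = 0" for p q
    proof -
      have "(\<Sum>j\<in>H \<times> {..<n}. conv_system G y j p * conjugate (conv_system G f j q))
          = conjugate (\<Sum>j\<in>H \<times> {..<n}. conv_system G f j q * conjugate (conv_system G y j p))"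
        by (simp add: conjugate_sum conjugate_mult mult.commute)
      then show ?thesis
        unfolding sum.distrib by (simp add: half conjugate_0)
    qed
    define w where "w m = (ell_norm G (y m) / a m)\<^sup>2" for m
    have "(\<Sum>j\<in>H \<times> {..<n}. of_real ((ell_norm G (y (snd j)) / a (snd j))\<^sup>2)
          * ell_inner G (S (conv_system G f j)) (conv_system G f j))
        = (\<Sum>j\<in>H \<times> {..<n}. ell_inner G (S (conv_system G (\<lambda>m g. of_real (w m) * f m g) j)) (conv_system G f j))"
      unfolding w_def
      by (intro sum.cong refl)
        (auto simp: conv_system_apply frame_operator_translation inner_translation_translation frame_operator_scale ell_inner_lin_left)
    then have eq: "(\<Sum>j\<in>H \<times> {..<n}. ell_inner G (S (conv_system G y j)) (conv_system G y j)
        - of_real ((ell_norm G (y (snd j)) / a (snd j))\<^sup>2) * ell_inner G (S (conv_system G f j)) (conv_system G f j))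
        = of_nat (card H) * (\<Sum>m<n. ell_inner G (S (y m)) (y m)
            - ell_inner G (S (\<lambda>g. of_real (w m) * f m g)) (f m))"
      unfolding sum_subtractf frame_operator_quadratic_translates right_diff_distrib by simp
    have "(\<Sum>m<n. ell_inner G (S (y m)) (y m) - ell_inner G (S (\<lambda>g. of_real (w m) * f m g)) (f m))
        = (\<Sum>m<n. of_real ((\<mu> - eigenvalue m) * (ell_norm G (y m))\<^sup>2))"
    proof (rule sum.cong[OF refl])
      fix m assume "m \<in> {..<n}"
      then have m: "m < n" by simp
      have "w m * (a m)\<^sup>2 = (ell_norm G (y m))\<^sup>2"
        using a_pos[OF m] by (simp add: w_def power_divide)
      then have "of_real (w m) * (of_real (eigenvalue m) * of_real ((a m)\<^sup>2))
          = (of_real (eigenvalue m * (ell_norm G (y m))\<^sup>2) :: 'k)"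
        by (metis mult.left_commute of_real_mult)
      then show "ell_inner G (S (y m)) (y m) - ell_inner G (S (\<lambda>g. of_real (w m) * f m g)) (f m)
          = of_real ((\<mu> - eigenvalue m) * (ell_norm G (y m))\<^sup>2)"
        unfolding Sy frame_operator_scale S_f[OF m] ell_inner_lin_left inner_f_self[OF m]
        by (simp add: ell_inner_self_norm left_diff_distrib)
    qed
    also have "\<dots> = (\<Sum>m\<in>K. of_real ((\<mu> - eigenvalue m) * (ell_norm G (y m))\<^sup>2))"
      using K by (intro sum.mono_neutral_right) (auto simp: y_def ell_norm_def ell_inner_lin_left)
    finally show "of_real c = (\<Sum>j\<in>H \<times> {..<n}. ell_inner G (S (conv_system G y j)) (conv_system G y j)
        - of_real ((ell_norm G (y (snd j)) / a (snd j))\<^sup>2) * ell_inner G (S (conv_system G f j)) (conv_system G f j))"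
      unfolding eq c_def by simp
  qed auto
  moreover have "card H > 0"
    using card_gt_0_iff H_closed(4) finite_H by blast
  ultimately have "0 \<le> (\<Sum>m\<in>K. (\<mu> - eigenvalue m) * (ell_norm G (y m))\<^sup>2)"
    by (auto simp: c_def zero_le_mult_iff)
  then have "(\<Sum>m\<in>K. (eigenvalue m - \<mu>) * (ell_norm G (y m))\<^sup>2) \<le> 0"
    by (simp add: left_diff_distrib sum_subtractf)
  moreover have nonneg: "0 \<le> (eigenvalue m - \<mu>) * (ell_norm G (y m))\<^sup>2" if "m \<in> K" for m
    using that K by simp
  ultimately have "(\<Sum>m\<in>K. (eigenvalue m - \<mu>) * (ell_norm G (y m))\<^sup>2) = 0"
    by (meson order_antisym sum_nonneg)
  moreover have "finite K"
    using K by simp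
  ultimately have "(ell_norm G (y m))\<^sup>2 = 0" if "m \<in> K" for m
    using that nonneg K by (subst (asm) sum_nonneg_eq_0_iff) auto
  then have "y m = 0" if "m \<in> K" for m
    using that ell_inner_self_eq_0[OF finite_carrier y_ell] by (simp add: ell_inner_self_norm)
  then show ?thesis
    by (metis y_def)
qed

end

section \<open>The spectrum of the frame operator of a local minimizer\<close>

context frame_potential_minimizer
begin

abbreviation \<xi> :: "'a \<times> nat \<Rightarrow> 'a \<Rightarrow> 'k" where "\<xi> \<equiv> conv_system G f"

lemma xi_in_ell: "\<xi> p \<in> ell G"
  by (cases p) (simp add: conv_system_apply)

lemma inner_xi_self:
  assumes "h \<in> H" "m < n"
  shows "ell_inner G (\<xi> (h, m)) (\<xi> (h, m)) = of_real ((a m)\<^sup>2)"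
  using assms by (simp only: conv_system_apply inner_translation_translation H_closed inner_f_self)

lemma xi_nonzero:
  assumes "h \<in> H" "m < n"
  shows "\<xi> (h, m) \<noteq> 0"
  using inner_xi_self[OF assms] a_pos[OF assms(2)] by (auto simp: ell_inner_lin_left)

lemma S_xi:
  assumes "h \<in> H" "m < n"
  shows "S (\<xi> (h, m)) = (\<lambda>g. of_real (eigenvalue m) * \<xi> (h, m) g)"
proof -
  have "S (\<xi> (h, m)) = translation G h (\<lambda>g. of_real (eigenvalue m) * f m g)"
    using assms by (simp add: conv_system_apply frame_operator_translation S_f)
  then show ?thesis
    by (auto simp: conv_system_apply translation_def)
qed

lemma a_sq_le_eigenvalue:
  assumes m: "m < n"
  shows "(a m)\<^sup>2 \<le> eigenvalue m"
proof -
  have "(norm (ell_inner G (f m) (\<xi> (\<one>, m))))\<^sup>2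
      \<le> (\<Sum>j\<in>H \<times> {..<n}. (norm (ell_inner G (f m) (\<xi> j)))\<^sup>2)"
    using m by (intro member_le_sum) auto
  also have "ell_inner G (f m) (\<xi> (\<one>, m)) = of_real ((a m)\<^sup>2)"
    by (simp only: conv_system_apply translation_one[OF f_in_ell[OF m]] inner_f_self[OF m])
  finally have "((a m)\<^sup>2)\<^sup>2 \<le> (\<Sum>j\<in>H \<times> {..<n}. (norm (ell_inner G (f m) (\<xi> j)))\<^sup>2)"
    by (simp only: norm_of_real power2_abs)
  then show ?thesis
    using a_pos[OF m] unfolding eigenvalue_def by (simp add: pos_le_divide_eq power2_eq_square)
qed

lemma eigenvalue_pos: "m < n \<Longrightarrow> eigenvalue m > 0"
  using a_sq_le_eigenvalue a_pos by (meson less_le_trans zero_less_power)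

text \<open>
The case \<open>\<mu> = 0\<close> is used for a vector orthogonal to the whole system, the other case for the least eigenvalue.
\<close>

lemma card_eigenvalue_greater:
  assumes e: "e \<in> ell G" "e \<noteq> 0" "S e = (\<lambda>g. of_real \<mu> * e g)"
  shows "card {m. m < n \<and> \<mu> < eigenvalue m} < card (rcosets H)"
proof (rule card_generators_less[OF _ e(1,2)])
  let ?K = "{m. m < n \<and> \<mu> < eigenvalue m}"
  show "ell_inner G (translation G h (f m)) e = 0" if "m \<in> ?K" "h \<in> H" for m h
    using eigenvectors_orthogonal[OF S_xi[of h m] e(3)] that by (simp add: conv_system_apply)
  show "\<forall>m\<in>?K. act (star (b m)) e = 0" if "\<And>g. (\<Sum>m\<in>?K. act (b m) (f m) g) = 0" for b
    using annihilation_from_relation[OF e(1,3) refl that] .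
qed simp

definition min_eigenvalue :: real where
  "min_eigenvalue = Min (eigenvalue ` {..<n})"

definition dominant :: "nat set" where
  "dominant = {m. m < n \<and> min_eigenvalue < eigenvalue m}"

lemma finite_dominant [simp]: "finite dominant"
  unfolding dominant_def by simp

lemma dominant_less: "m \<in> dominant \<Longrightarrow> m < n"
  unfolding dominant_def by simp

lemma eigenvalue_not_dominant:
  assumes "m < n" "m \<notin> dominant"
  shows "eigenvalue m = min_eigenvalue"
proof -
  have "min_eigenvalue \<le> eigenvalue m"
    unfolding min_eigenvalue_def using assms(1) by (intro Min_le) auto
  then show ?thesis
    using assms by (simp add: dominant_def)
qed

lemma inner_dominant_rest:
  assumes "h \<in> H" "k \<in> H" "m \<in> dominant" "j < n" "j \<notin> dominant"
  shows "ell_inner G (\<xi> (h, m)) (\<xi> (k, j)) = 0" "ell_inner G (\<xi> (k, j)) (\<xi> (h, m)) = 0"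
proof -
  have ne: "eigenvalue m \<noteq> eigenvalue j"
    using assms(3) eigenvalue_not_dominant[OF assms(4,5)] by (simp add: dominant_def)
  show "ell_inner G (\<xi> (h, m)) (\<xi> (k, j)) = 0"
    by (rule eigenvectors_orthogonal[OF S_xi S_xi ne]) (use assms dominant_less in auto)
  then show "ell_inner G (\<xi> (k, j)) (\<xi> (h, m)) = 0"
    by (subst ell_inner_commute) (simp add: conjugate_0)
qed

lemma card_rcosets_pos: "card (rcosets H) > 0"
proof -
  have "order G > 0"
    using finite_carrier by (simp add: order_gt_0_iff_finite)
  then show ?thesis
    using lagrange_finite[OF finite_carrier subgroup_H] by (metis gr0I mult_0)
qed

context
  assumes index_le: "card (rcosets H) \<le> n"
begin

lemma n_pos: "n > 0"
  using index_le card_rcosets_pos by simp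

lemma min_eigenvalue_attained: obtains m where "m < n" "eigenvalue m = min_eigenvalue"
proof -
  have "min_eigenvalue \<in> eigenvalue ` {..<n}"
    unfolding min_eigenvalue_def using n_pos by (intro Min_in) auto
  then show ?thesis
    using that by auto
qed

lemma min_eigenvalue_pos: "min_eigenvalue > 0"
  using min_eigenvalue_attained eigenvalue_pos by metis

lemma card_dominant: "card dominant < card (rcosets H)"
proof -
  obtain m where m: "m < n" "eigenvalue m = min_eigenvalue"
    using min_eigenvalue_attained .
  have "f m \<noteq> 0"
    using inner_f_self[OF m(1)] a_pos[OF m(1)] by (auto simp: ell_inner_lin_left)
  then show ?thesis
    using card_eigenvalue_greater[OF f_in_ell[OF m(1)] _ S_f[OF m(1)]] m(2) by (simp add: dominant_def)
qed

text \<open>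
A nonzero vector orthogonal to the system is an eigenvector for \<open>0\<close>, and all \<open>n\<close> generators have a positive eigenvalue.
\<close>

lemma ell_subset_span: "ell G \<subseteq> fun_space.span (\<xi> ` (H \<times> {..<n}))"
proof (rule ccontr)
  assume ne: "\<not> ?thesis"
  have sub: "\<xi> ` (H \<times> {..<n}) \<subseteq> ell G"
    using xi_in_ell by auto
  have fin: "finite (\<xi> ` (H \<times> {..<n}))"
    by simp
  obtain e where e: "e \<in> ell G" "e \<noteq> 0" "\<And>w. w \<in> fun_space.span (\<xi> ` (H \<times> {..<n})) \<Longrightarrow> ell_inner G e w = 0"
    using exists_orthogonal_to_proper_span[OF finite_carrier fin sub ne] by blast
  have "S e = (\<lambda>g. of_real 0 * e g)"
    unfolding frame_operator_def using e(3) by (auto intro!: sum.neutral simp: fun_space.span_base)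
  from card_eigenvalue_greater[OF e(1,2) this] have "card {m. m < n \<and> 0 < eigenvalue m} < n"
    using index_le by simp
  moreover have "{m. m < n \<and> 0 < eigenvalue m} = {..<n}"
    using eigenvalue_pos by auto
  ultimately show False
    by simp
qed

lemma S_span_rest:
  assumes "u \<in> fun_space.span (\<xi> ` (H \<times> ({..<n} - dominant)))"
  shows "S u = (\<lambda>g. of_real min_eigenvalue * u g)" "u \<in> ell G"
    "\<And>p. p \<in> H \<times> dominant \<Longrightarrow> ell_inner G u (\<xi> p) = 0"
proof -
  have "fun_space.subspace {u. S u = (\<lambda>g. of_real min_eigenvalue * u g)}"
    by (rule fun_space.subspaceI)
      (auto simp: frame_operator_zero frame_operator_add frame_operator_scale fun_eq_iff distrib_left)
  moreover have "\<xi> ` (H \<times> ({..<n} - dominant)) \<subseteq> {u. S u = (\<lambda>g. of_real min_eigenvalue * u g)}"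
    using S_xi eigenvalue_not_dominant by auto
  ultimately show "S u = (\<lambda>g. of_real min_eigenvalue * u g)"
    using fun_space.span_minimal assms by blast
  have "\<xi> ` (H \<times> ({..<n} - dominant)) \<subseteq> ell G"
    using xi_in_ell by auto
  then show "u \<in> ell G"
    using fun_space.span_minimal[OF _ subspace_ell] assms by blast
  fix p assume p: "p \<in> H \<times> dominant"
  have "fun_space.subspace {u. ell_inner G u (\<xi> p) = 0}"
    by (rule fun_space.subspaceI) (auto simp: ell_inner_lin_left)
  moreover have "\<xi> ` (H \<times> ({..<n} - dominant)) \<subseteq> {u. ell_inner G u (\<xi> p) = 0}"
    using p inner_dominant_rest(2) by auto
  ultimately show "ell_inner G u (\<xi> p) = 0"
    using fun_space.span_minimal assms by blast
qed

lemma annihilator_of_min_eigenspace: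
  assumes b: "b \<in> supported" and ann: "\<And>e. e \<in> ell G \<Longrightarrow> S e = (\<lambda>g. of_real min_eigenvalue * e g) \<Longrightarrow> act b e = 0"
  shows "b = 0"
proof (rule annihilator_of_corank_eq_0[OF finite_dominant card_dominant b])
  fix v :: "'a \<Rightarrow> 'k" assume "v \<in> ell G"
  then have "v \<in> fun_space.span (\<xi> ` (H \<times> {..<n}))"
    using ell_subset_span by blast
  also have "H \<times> {..<n} = H \<times> dominant \<union> H \<times> ({..<n} - dominant)"
    using dominant_less by auto
  finally obtain w u where "v = w + u" "w \<in> fun_space.span (\<xi> ` (H \<times> dominant))"
      and u: "u \<in> fun_space.span (\<xi> ` (H \<times> ({..<n} - dominant)))"
    unfolding image_Un fun_space.span_Un by blast
  moreover have "act b u = 0"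
    using ann S_span_rest[OF u] by blast
  ultimately show "\<exists>w u. v = w + u
      \<and> w \<in> fun_space.span ((\<lambda>(h, m). translation G h (f m)) ` (H \<times> dominant)) \<and> act b u = 0"
    unfolding conv_system_def by blast
qed

text \<open>
A relation makes \<open>(b m)\<^sup>*\<close> annihilate the whole eigenspace of the least eigenvalue, and only \<open>0\<close> does so.
\<close>

lemma dominant_free:
  assumes b: "\<And>m. m \<in> dominant \<Longrightarrow> b m \<in> supported"
    and rel: "\<And>g. (\<Sum>m\<in>dominant. act (b m) (f m) g) = 0" and m: "m \<in> dominant"
  shows "b m = 0"
proof -
  have "star (b m) = 0"
    using annihilator_of_min_eigenspace[OF star_supported]
      annihilation_from_relation[OF _ _ dominant_def rel] m by blast
  then have "star (star (b m)) h = 0" for h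
    unfolding star_def[of "star (b m)"] by (simp add: conjugate_0)
  then have "star (star (b m)) = 0"
    by auto
  then show ?thesis
    using star_star[OF b[OF m]] by simp
qed

text \<open>
Expanding \<open>S (f m) = \<lambda>\<^sub>m f m\<close> in the system gives a relation between the dominant generators, because the other
ones are orthogonal to \<open>f m\<close>. By freeness its coefficients vanish.
\<close>

lemma inner_dominant:
  assumes m: "m \<in> dominant" and j: "j \<in> dominant" and h: "h \<in> H"
  shows "ell_inner G (f m) (\<xi> (h, j)) = (if j = m \<and> h = \<one> then of_real (eigenvalue m) else 0)"
proof -
  define b where "b i = (\<lambda>k. if k \<in> H then
      ell_inner G (f m) (\<xi> (k, i)) - (if i = m \<and> k = \<one> then of_real (eigenvalue m) else 0) else 0)" for i
  have f1: "\<xi> (\<one>, m) = f m"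
    using m by (simp add: conv_system_apply translation_one f_in_ell dominant_less)
  have "(\<Sum>i\<in>dominant. act (b i) (f i) g) = 0" for g
  proof -
    have "S (f m) g = (\<Sum>i<n. \<Sum>k\<in>H. ell_inner G (f m) (\<xi> (k, i)) * \<xi> (k, i) g)"
      unfolding frame_operator_def by (subst sum.swap) (simp add: sum.cartesian_product)
    also have "\<dots> = (\<Sum>i\<in>dominant. \<Sum>k\<in>H. ell_inner G (f m) (\<xi> (k, i)) * \<xi> (k, i) g)"
    proof (rule sum.mono_neutral_right)
      show "\<forall>i\<in>{..<n} - dominant. (\<Sum>k\<in>H. ell_inner G (f m) (\<xi> (k, i)) * \<xi> (k, i) g) = 0"
        using inner_dominant_rest(1)[of \<one> _ m] m f1 by auto
    qed (use dominant_less in auto)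
    finally have Sg: "S (f m) g = (\<Sum>i\<in>dominant. \<Sum>k\<in>H. ell_inner G (f m) (\<xi> (k, i)) * \<xi> (k, i) g)" .
    have "(\<Sum>i\<in>dominant. \<Sum>k\<in>H. (if i = m \<and> k = \<one> then of_real (eigenvalue m) else 0) * \<xi> (k, i) g)
        = (\<Sum>i\<in>dominant. if i = m then (\<Sum>k\<in>H. if k = \<one> then of_real (eigenvalue m) * f m g else 0) else 0)"
    proof (intro sum.cong refl)
      fix i
      show "(\<Sum>k\<in>H. (if i = m \<and> k = \<one> then of_real (eigenvalue m) else 0) * \<xi> (k, i) g)
          = (if i = m then (\<Sum>k\<in>H. if k = \<one> then of_real (eigenvalue m) * f m g else 0) else 0)"
      proof (cases "i = m")
        case True
        then show ?thesis
          unfolding if_P[OF True] by (intro sum.cong refl) (simp add: f1)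
      qed simp
    qed
    also have "\<dots> = of_real (eigenvalue m) * f m g"
      using m by simp
    finally have "(\<Sum>i\<in>dominant. act (b i) (f i) g) = S (f m) g - of_real (eigenvalue m) * f m g"
      unfolding Sg act_def b_def by (simp add: conv_system_apply left_diff_distrib sum_subtractf)
    then show ?thesis
      using S_f[OF dominant_less[OF m]] by simp
  qed
  moreover have "b i \<in> supported" for i
    unfolding b_def supported_def by simp
  ultimately have "b j = 0"
    using dominant_free[of b] j by blast
  then have "b j h = 0"
    by simp
  then show ?thesis
    using h unfolding b_def by simp
qed

lemma dominant_eigenvalue:
  assumes m: "m \<in> dominant"
  shows "eigenvalue m = (a m)\<^sup>2"
proof -
  have "of_real (eigenvalue m) = ell_inner G (f m) (\<xi> (\<one>, m))"
    using inner_dominant[OF m m, of \<one>] by simp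
  also have "\<dots> = of_real ((a m)\<^sup>2)"
    using m by (simp only: conv_system_apply translation_one f_in_ell dominant_less inner_f_self)
  finally show ?thesis
    by (simp only: of_real_eq_iff)
qed

lemma dominant_orthogonal:
  assumes "p \<in> H \<times> dominant" "q \<in> H \<times> dominant" "p \<noteq> q"
  shows "ell_inner G (\<xi> p) (\<xi> q) = 0"
proof -
  obtain h m k j where pq: "p = (h, m)" "q = (k, j)" and hm: "h \<in> H" "k \<in> H" "m \<in> dominant" "j \<in> dominant"
    using assms by auto
  have "ell_inner G (\<xi> p) (\<xi> q) = ell_inner G (f m) (\<xi> (inv h \<otimes> k, j))"
    using hm by (simp add: pq conv_system_apply inner_translation_adjoint translation_translation)
  moreover have "\<not> (j = m \<and> inv h \<otimes> k = \<one>)"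
  proof
    assume *: "j = m \<and> inv h \<otimes> k = \<one>"
    have "k = h \<otimes> (inv h \<otimes> k)"
      using hm by simp
    also have "\<dots> = h"
      using hm by (simp only: * r_one H_closed)
    finally show False
      using * assms(3) by (simp add: pq)
  qed
  ultimately show ?thesis
    using inner_dominant[OF hm(3,4), of "inv h \<otimes> k"] hm by simp
qed

text \<open>
On the dominant part \<open>S\<close> acts by \<open>\<lambda>\<^sub>m = a\<^sub>m\<^sup>2\<close> and elsewhere by the least eigenvalue; the second summand is
the projection to the dominant part, weighted by the differences of the eigenvalues.
\<close>

lemma S_decomposition:
  assumes "v \<in> ell G"
  shows "S v = (\<lambda>g. of_real min_eigenvalue * v g + (\<Sum>p\<in>H \<times> dominant.
    of_real (1 - min_eigenvalue / eigenvalue (snd p)) * (ell_inner G v (\<xi> p) * \<xi> p g)))"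
proof -
  define c :: "'a \<times> nat \<Rightarrow> 'k" where "c p = of_real (1 - min_eigenvalue / eigenvalue (snd p))" for p
  define R where "R v = (\<lambda>g. of_real min_eigenvalue * v g + (\<Sum>p\<in>H \<times> dominant. c p * (ell_inner G v (\<xi> p) * \<xi> p g)))" for v
  have "fun_space.subspace {v. S v = R v}"
  proof (rule fun_space.subspaceI; clarsimp)
    show "S 0 = R 0"
      by (simp add: frame_operator_zero R_def ell_inner_lin_left fun_eq_iff)
  next
    fix u w assume "S u = R u" "S w = R w"
    then have "S (u + w) = R u + R w"
      by (simp add: frame_operator_add)
    also have "\<dots> = R (u + w)"
      by (simp add: R_def fun_eq_iff ell_inner_lin_left algebra_simps sum.distrib)
    finally show "S (u + w) = R (u + w)" .
  next
    fix k u assume "S u = R u"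
    then have "S (\<lambda>g. k * u g) = (\<lambda>g. k * R u g)"
      by (simp add: frame_operator_scale)
    also have "\<dots> = R (\<lambda>g. k * u g)"
      by (simp add: R_def fun_eq_iff ell_inner_lin_left algebra_simps sum_distrib_left)
    finally show "S (\<lambda>g. k * u g) = R (\<lambda>g. k * u g)" .
  qed
  moreover have "\<xi> (h, m) \<in> {v. S v = R v}" if hm: "h \<in> H" "m < n" for h m
  proof -
    have "(\<Sum>p\<in>H \<times> dominant. c p * (ell_inner G (\<xi> (h, m)) (\<xi> p) * \<xi> p g))
        = of_real (eigenvalue m - min_eigenvalue) * \<xi> (h, m) g" for g
    proof (cases "m \<in> dominant")
      case True
      have "(\<Sum>p\<in>H \<times> dominant. c p * (ell_inner G (\<xi> (h, m)) (\<xi> p) * \<xi> p g))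
          = (\<Sum>p\<in>H \<times> dominant. if p = (h, m) then c p * (of_real (eigenvalue m) * \<xi> p g) else 0)"
        using dominant_orthogonal[of "(h, m)"] True hm
        by (intro sum.cong refl) (auto simp: inner_xi_self dominant_eigenvalue)
      also have "\<dots> = c (h, m) * (of_real (eigenvalue m) * \<xi> (h, m) g)"
        using True hm by simp
      also have "\<dots> = of_real ((1 - min_eigenvalue / eigenvalue m) * eigenvalue m) * \<xi> (h, m) g"
        by (simp only: c_def snd_conv of_real_mult mult.assoc)
      also have "(1 - min_eigenvalue / eigenvalue m) * eigenvalue m = eigenvalue m - min_eigenvalue"
        using eigenvalue_pos[OF hm(2)] by (simp add: field_simps)
      finally show ?thesis .
    next
      case False
      then show ?thesis
        using inner_dominant_rest(2)[OF _ hm(1) _ hm(2) False] eigenvalue_not_dominant[OF hm(2) False]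
        by (auto intro!: sum.neutral)
    qed
    then show ?thesis
      by (simp add: R_def S_xi[OF hm] left_diff_distrib)
  qed
  ultimately have "v \<in> {v. S v = R v}"
    using fun_space.span_minimal[of "\<xi> ` (H \<times> {..<n})" "{v. S v = R v}"] ell_subset_span assms by auto
  then show ?thesis
    unfolding R_def c_def by simp
qed

lemma frame_energy:
  assumes v: "v \<in> ell G"
  shows "(\<Sum>j\<in>H \<times> {..<n}. (norm (ell_inner G v (\<xi> j)))\<^sup>2) = min_eigenvalue * (ell_norm G v)\<^sup>2
    + (\<Sum>p\<in>H \<times> dominant. (1 - min_eigenvalue / eigenvalue (snd p)) * (norm (ell_inner G v (\<xi> p)))\<^sup>2)"
proof -
  have "ell_inner G v (\<xi> p) * ell_inner G (\<xi> p) v = of_real ((norm (ell_inner G v (\<xi> p)))\<^sup>2)" for p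
    by (subst (2) ell_inner_commute) (rule mult_conjugate)
  then have "ell_inner G (S v) v = of_real (min_eigenvalue * (ell_norm G v)\<^sup>2
    + (\<Sum>p\<in>H \<times> dominant. (1 - min_eigenvalue / eigenvalue (snd p)) * (norm (ell_inner G v (\<xi> p)))\<^sup>2))"
    unfolding S_decomposition[OF v] ell_inner_lin_left ell_inner_sum_left ell_inner_self_norm
    by (simp only: of_real_add of_real_mult of_real_sum)
  then show ?thesis
    unfolding frame_operator_quadratic_form of_real_eq_iff .
qed

text \<open>
The trace of \<open>S\<close>, computed from the point masses, is the sum of the squared norms of the system. Comparing it with the
trace of the decomposition above determines the least eigenvalue.
\<close>

lemma sum_rest_eq:
  "(\<Sum>m\<in>{..<n} - dominant. (a m)\<^sup>2) = min_eigenvalue * (real (card (rcosets H)) - real (card dominant))"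
proof -
  have norm_x: "(ell_norm G (\<xi> (h, m)))\<^sup>2 = (a m)\<^sup>2" if "h \<in> H" "m < n" for h m
    using inner_xi_self[OF that] by (simp only: ell_inner_self_norm of_real_eq_iff)
  have "(\<Sum>g\<in>carrier G. \<Sum>j\<in>H \<times> {..<n}. (norm (ell_inner G (delta g) (\<xi> j)))\<^sup>2)
      = (\<Sum>j\<in>H \<times> {..<n}. (ell_norm G (\<xi> j))\<^sup>2)"
    by (subst sum.swap) (simp only: sum_norm_inner_delta[OF finite_carrier])
  also have "\<dots> = (\<Sum>h\<in>H. \<Sum>m<n. (a m)\<^sup>2)"
    unfolding sum.cartesian_product by (intro sum.cong refl) (auto simp: norm_x)
  finally have lhs: "(\<Sum>g\<in>carrier G. \<Sum>j\<in>H \<times> {..<n}. (norm (ell_inner G (delta g) (\<xi> j)))\<^sup>2)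
      = real (card H) * (\<Sum>m<n. (a m)\<^sup>2)"
    by simp
  have "(\<Sum>g\<in>carrier G. \<Sum>p\<in>H \<times> dominant. (1 - min_eigenvalue / eigenvalue (snd p)) * (norm (ell_inner G (delta g) (\<xi> p)))\<^sup>2)
      = (\<Sum>p\<in>H \<times> dominant. (1 - min_eigenvalue / eigenvalue (snd p)) * (ell_norm G (\<xi> p))\<^sup>2)"
    by (subst sum.swap) (simp only: sum_distrib_left[symmetric] sum_norm_inner_delta[OF finite_carrier])
  also have "\<dots> = (\<Sum>p\<in>H \<times> dominant. (a (snd p))\<^sup>2 - min_eigenvalue)"
  proof (intro sum.cong refl)
    fix p assume "p \<in> H \<times> dominant"
    then obtain h m where "p = (h, m)" "h \<in> H" "m \<in> dominant" by auto
    then show "(1 - min_eigenvalue / eigenvalue (snd p)) * (ell_norm G (\<xi> p))\<^sup>2 = (a (snd p))\<^sup>2 - min_eigenvalue"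
      using a_pos[of m] dominant_less[of m] by (simp add: norm_x dominant_eigenvalue field_simps)
  qed
  also have "\<dots> = (\<Sum>h\<in>H. \<Sum>m\<in>dominant. (a m)\<^sup>2 - min_eigenvalue)"
    unfolding sum.cartesian_product by (simp add: case_prod_beta)
  also have "\<dots> = real (card H) * ((\<Sum>m\<in>dominant. (a m)\<^sup>2) - real (card dominant) * min_eigenvalue)"
    by (simp add: sum_subtractf)
  finally have rhs: "(\<Sum>g\<in>carrier G. \<Sum>p\<in>H \<times> dominant. (1 - min_eigenvalue / eigenvalue (snd p)) * (norm (ell_inner G (delta g) (\<xi> p)))\<^sup>2)
      = real (card H) * ((\<Sum>m\<in>dominant. (a m)\<^sup>2) - real (card dominant) * min_eigenvalue)" .
  have delta_ell: "(delta g :: 'a \<Rightarrow> 'k) \<in> ell G" if "g \<in> carrier G" for g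
    using that by (auto simp: delta_def ell_def)
  have "(\<Sum>g\<in>carrier G. \<Sum>j\<in>H \<times> {..<n}. (norm (ell_inner G (delta g) (\<xi> j)))\<^sup>2)
      = (\<Sum>g\<in>carrier G. min_eigenvalue
        + (\<Sum>p\<in>H \<times> dominant. (1 - min_eigenvalue / eigenvalue (snd p)) * (norm (ell_inner G (delta g) (\<xi> p)))\<^sup>2))"
    by (intro sum.cong refl) (simp only: frame_energy[OF delta_ell] ell_norm_delta[OF finite_carrier] mult_1_right)
  then have "real (card H) * (\<Sum>m<n. (a m)\<^sup>2) = real (card (carrier G)) * min_eigenvalue
      + real (card H) * ((\<Sum>m\<in>dominant. (a m)\<^sup>2) - real (card dominant) * min_eigenvalue)"
    unfolding sum.distrib lhs rhs by simp
  also have "real (card (carrier G)) = real (card H) * real (card (rcosets H))"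
    using lagrange_finite[OF finite_carrier subgroup_H] by (simp add: order_def mult.commute flip: of_nat_mult)
  finally have "real (card H) * (\<Sum>m<n. (a m)\<^sup>2) = real (card H) * (real (card (rcosets H)) * min_eigenvalue
      + ((\<Sum>m\<in>dominant. (a m)\<^sup>2) - real (card dominant) * min_eigenvalue))"
    by (simp add: algebra_simps)
  moreover have "card H > 0"
    using card_gt_0_iff H_closed(4) finite_H by blast
  ultimately have "(\<Sum>m<n. (a m)\<^sup>2) = real (card (rcosets H)) * min_eigenvalue
      + ((\<Sum>m\<in>dominant. (a m)\<^sup>2) - real (card dominant) * min_eigenvalue)"
    by auto
  moreover have "(\<Sum>m<n. (a m)\<^sup>2) = (\<Sum>m\<in>{..<n} - dominant. (a m)\<^sup>2) + (\<Sum>m\<in>dominant. (a m)\<^sup>2)"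
    using dominant_less by (intro sum.subset_diff) auto
  ultimately show ?thesis
    by (simp add: algebra_simps)
qed

lemma dominant_iff:
  assumes "m < n"
  shows "m \<in> dominant \<longleftrightarrow> min_eigenvalue < (a m)\<^sup>2"
  using assms dominant_eigenvalue[of m] a_sq_le_eigenvalue[OF assms] eigenvalue_not_dominant[OF assms]
  by (auto simp: dominant_def)

lemma dominant_initial_segment:
  assumes mono: "\<And>i j. i \<le> j \<Longrightarrow> j < n \<Longrightarrow> a j \<le> a i"
  shows "dominant = {..<card dominant}"
proof -
  have down: "i \<in> dominant" if "i \<le> j" "j \<in> dominant" for i j
  proof -
    have j: "j < n" and i: "i < n"
      using dominant_less[OF that(2)] that(1) by auto
    have "(a j)\<^sup>2 \<le> (a i)\<^sup>2"
      using mono[OF that(1) j] a_pos[OF j] by (intro power_mono) auto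
    then show ?thesis
      using that(2) by (simp add: dominant_iff i j)
  qed
  define k where "k = (LEAST k. k \<notin> dominant)"
  have k: "k \<notin> dominant"
    unfolding k_def by (rule LeastI[of _ n]) (use dominant_less in blast)
  have "dominant = {..<k}"
  proof (intro equalityI subsetI)
    fix i assume "i \<in> dominant"
    then show "i \<in> {..<k}"
      using down[of k i] k by (simp add: not_le[symmetric]) blast
  next
    fix i assume "i \<in> {..<k}"
    then show "i \<in> dominant"
      using not_less_Least[of i "\<lambda>k. k \<notin> dominant"] unfolding k_def by auto
  qed
  then show ?thesis
    by (metis card_lessThan)
qed

text \<open>
At \<open>k = card dominant\<close> the inequality says \<open>a\<^sub>k\<^sup>2 \<le> \<mu>\<close>, with \<open>\<mu>\<close> the least eigenvalue. For \<open>m < k\<close> it fails: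
\<open>a\<^sub>m\<^sup>2\<close> bounds the terms up to \<open>k\<close> and exceeds \<open>\<mu>\<close>, the mean of the remaining sum over \<open>d - k\<close> places.
\<close>

lemma threshold_index:
  assumes mono: "\<And>i j. i \<le> j \<Longrightarrow> j < n \<Longrightarrow> a j \<le> a i"
  shows "(LEAST m. m < card (rcosets H) \<and> (real (card (rcosets H)) - real m) * (a m)\<^sup>2 \<le> (\<Sum>j=m..<n. (a j)\<^sup>2))
    = card dominant"
proof (rule Least_equality)
  let ?d = "card (rcosets H)" and ?k = "card dominant"
  have rest: "(\<Sum>j=?k..<n. (a j)\<^sup>2) = min_eigenvalue * (real ?d - real ?k)"
  proof -
    have "{..<n} - dominant = {?k..<n}"
      by (subst dominant_initial_segment[OF mono]) auto
    then show ?thesis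
      using sum_rest_eq by simp
  qed
  have k: "?k < ?d" "?k < n"
    using card_dominant index_le by auto
  have "?k \<notin> dominant"
    by (subst dominant_initial_segment[OF mono]) auto
  then have "(a ?k)\<^sup>2 \<le> min_eigenvalue"
    using dominant_iff[OF k(2)] by simp
  then show "?k < ?d \<and> (real ?d - real ?k) * (a ?k)\<^sup>2 \<le> (\<Sum>j=?k..<n. (a j)\<^sup>2)"
    unfolding rest using k(1) by (simp add: mult.commute mult_left_mono)
  fix m assume m: "m < ?d \<and> (real ?d - real m) * (a m)\<^sup>2 \<le> (\<Sum>j=m..<n. (a j)\<^sup>2)"
  show "?k \<le> m"
  proof (rule ccontr)
    assume "\<not> ?k \<le> m"
    then have mk: "m < ?k" by simp
    then have "m \<in> dominant"
      by (subst dominant_initial_segment[OF mono]) auto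
    then have less: "min_eigenvalue < (a m)\<^sup>2"
      using dominant_iff[of m] mk k(2) by simp
    have "(\<Sum>j=m..<n. (a j)\<^sup>2) = (\<Sum>j=m..<?k. (a j)\<^sup>2) + (\<Sum>j=?k..<n. (a j)\<^sup>2)"
      using mk k(2) by (intro sum.atLeastLessThan_concat[symmetric]) auto
    also have "(\<Sum>j=m..<?k. (a j)\<^sup>2) \<le> (\<Sum>j=m..<?k. (a m)\<^sup>2)"
      using k(2) mono a_pos by (intro sum_mono power_mono) (auto intro: less_imp_le)
    also have "(\<Sum>j=m..<?k. (a m)\<^sup>2) = (real ?k - real m) * (a m)\<^sup>2"
      using mk by (simp add: of_nat_diff)
    also have "(\<Sum>j=?k..<n. (a j)\<^sup>2) < (real ?d - real ?k) * (a m)\<^sup>2"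
      unfolding rest using less k(1) by (simp add: mult.commute)
    finally show False
      using m by (simp add: algebra_simps)
  qed
qed

text \<open>
The dominant translates are an orthogonal family of \<open>card H * card dominant\<close> nonzero vectors, and together with a basis of the
remaining span they form a basis of \<open>\<ell>(G)\<close>.
\<close>

lemma dim_span_rest:
  "fun_space.dim (fun_space.span (\<xi> ` (H \<times> ({..<n} - dominant))))
    = card H * (card (rcosets H) - card dominant)"
proof -
  let ?X1 = "\<xi> ` (H \<times> dominant)" and ?X2 = "\<xi> ` (H \<times> ({..<n} - dominant))"
  have inj: "inj_on \<xi> (H \<times> dominant)"
  proof (rule inj_onI, rule ccontr)
    fix p q assume pq: "p \<in> H \<times> dominant" "q \<in> H \<times> dominant" "\<xi> p = \<xi> q" "p \<noteq> q"
    then have "ell_inner G (\<xi> p) (\<xi> p) = 0"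
      using dominant_orthogonal[of p q] by simp
    then have "\<xi> p = 0"
      by (rule ell_inner_self_eq_0[OF finite_carrier xi_in_ell])
    then show False
      using pq(1) xi_nonzero dominant_less by force
  qed
  have ind1: "fun_space.independent ?X1"
  proof (rule independent_orthogonal[OF finite_carrier])
    show "0 \<notin> ?X1"
    proof
      assume "0 \<in> ?X1"
      then obtain h m where "\<xi> (h, m) = 0" "h \<in> H" "m \<in> dominant"
        by force
      then show False
        using xi_nonzero dominant_less by blast
    qed
    show "ell_inner G u v = 0" if uv: "u \<in> ?X1" "v \<in> ?X1" "u \<noteq> v" for u v
    proof -
      obtain p q where "u = \<xi> p" "v = \<xi> q" "p \<in> H \<times> dominant" "q \<in> H \<times> dominant"
        using uv(1,2) by (elim imageE)
      then show ?thesis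
        using uv(3) dominant_orthogonal[of p q] by blast
    qed
  qed (use xi_in_ell in auto)
  obtain B where B: "B \<subseteq> ?X2" "fun_space.independent B" "?X2 \<subseteq> fun_space.span B"
    using fun_space.maximal_independent_subset by blast
  have fB: "finite B"
    using finite_subset[OF B(1)] by simp
  have un: "fun_space.independent (?X1 \<union> B) \<and> ?X1 \<inter> B = {}"
  proof (rule independent_Un_orthogonal[OF finite_carrier _ fB])
    fix u v assume "u \<in> ?X1" "v \<in> B"
    then obtain h m k j where "u = \<xi> (h, m)" "v = \<xi> (k, j)" "h \<in> H" "k \<in> H" "m \<in> dominant" "j < n" "j \<notin> dominant"
      using B(1) by blast
    then show "ell_inner G u v = 0"
      using inner_dominant_rest(1) by simp
  qed (use xi_in_ell B ind1 in auto)
  have "ell G \<subseteq> fun_space.span (?X1 \<union> B)"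
  proof -
    have "\<xi> ` (H \<times> {..<n}) \<subseteq> ?X1 \<union> ?X2"
      by auto
    also have "\<dots> \<subseteq> fun_space.span (?X1 \<union> B)"
      using B(3) fun_space.span_mono[of B "?X1 \<union> B"] fun_space.span_superset[of "?X1 \<union> B"] by blast
    finally have "fun_space.span (\<xi> ` (H \<times> {..<n})) \<subseteq> fun_space.span (?X1 \<union> B)"
      by (rule fun_space.span_minimal) (rule fun_space.subspace_span)
    then show ?thesis
      using ell_subset_span by (rule order_trans[rotated])
  qed
  moreover have "?X1 \<union> B \<subseteq> ell G"
    using xi_in_ell B(1) by auto
  ultimately have "card (?X1 \<union> B) = card (carrier G)"
    using fun_space.basis_card_eq_dim un dim_ell[OF finite_carrier] by metis
  moreover have "card (?X1 \<union> B) = card H * card dominant + card B"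
    using un fB by (subst card_Un_disjoint) (auto simp: card_image[OF inj] card_cartesian_product)
  ultimately have "card B = card H * (card (rcosets H) - card dominant)"
    using lagrange_finite[OF finite_carrier subgroup_H]
    by (simp add: order_def diff_mult_distrib2 mult.commute)
  moreover have "fun_space.span ?X2 = fun_space.span B"
    using B by (metis fun_space.span_mono fun_space.span_span subset_antisym)
  ultimately show ?thesis
    using fun_space.dim_span_eq_card_independent[OF B(2)] by simp
qed

lemma tight_frame_rest:
  "tight_frame G (fun_space.span (\<xi> ` (H \<times> ({..<n} - dominant)))) (H \<times> ({..<n} - dominant)) \<xi>"
proof -
  have "(\<Sum>j\<in>H \<times> ({..<n} - dominant). (norm (ell_inner G v (\<xi> j)))\<^sup>2) = min_eigenvalue * (ell_norm G v)\<^sup>2"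
    if v: "v \<in> fun_space.span (\<xi> ` (H \<times> ({..<n} - dominant)))" for v
  proof -
    note rest = S_span_rest[OF v]
    have "(\<Sum>j\<in>H \<times> ({..<n} - dominant). (norm (ell_inner G v (\<xi> j)))\<^sup>2)
        = (\<Sum>j\<in>H \<times> {..<n}. (norm (ell_inner G v (\<xi> j)))\<^sup>2)"
      using rest(3) by (intro sum.mono_neutral_left) auto
    also have "\<dots> = min_eigenvalue * (ell_norm G v)\<^sup>2"
      unfolding frame_energy[OF rest(2)] using rest(3) by (simp add: sum.neutral)
    finally show ?thesis .
  qed
  then show ?thesis
    unfolding tight_frame_def using min_eigenvalue_pos by (auto intro: fun_space.span_base)
qed

lemma tight_frame_ell:
  assumes "dominant = {}"
  shows "tight_frame G (ell G) (H \<times> {..<n}) \<xi>"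
  unfolding tight_frame_def using min_eigenvalue_pos frame_energy xi_in_ell assms by auto

end

end

section \<open>The structure of local minimizers\<close>

theorem theorem4p2:
  fixes G :: "('a, 'b) monoid_scheme"
    and H :: "'a set"
    and n d m0 :: nat
    and a :: "nat \<Rightarrow> real"
    and f :: "nat \<Rightarrow> 'a \<Rightarrow> 'k::real_or_complex"
  assumes "comm_group G" and "finite (carrier G)" and "subgroup H G"
    and "d = card (rcosets\<^bsub>G\<^esub> H)"
    and "n \<ge> d"
    and "\<And>i j. i \<le> j \<Longrightarrow> j < n \<Longrightarrow> a j \<le> a i"
    and "\<And>i. i < n \<Longrightarrow> a i > 0"
    and "m0 = (LEAST m. m < d \<and> (real d - real m) * (a m)\<^sup>2 \<le> (\<Sum>j=m..<n. (a j)\<^sup>2))"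
    and "\<And>m. m < n \<Longrightarrow> f m \<in> ell G"
    and "local_minimizer_FP G H n a f"
  shows "H \<times> {..<n} = (H \<times> {..<m0}) \<union> (H \<times> {m0..<n}) \<and>
    (\<forall>p \<in> H \<times> {..<m0}. \<forall>q \<in> H \<times> {m0..<n}.
       ell_inner G (conv_system G f p) (conv_system G f q) = 0) \<and>
    (\<forall>p \<in> H \<times> {..<m0}. conv_system G f p \<noteq> 0 \<and>
       (\<forall>q \<in> H \<times> {..<m0}. p \<noteq> q \<longrightarrow>
          ell_inner G (conv_system G f p) (conv_system G f q) = 0)) \<and>
    tight_frame G (fun_space.span (conv_system G f ` (H \<times> {m0..<n})))
      (H \<times> {m0..<n}) (conv_system G f) \<and>
    fun_space.dim (fun_space.span (conv_system G f ` (H \<times> {m0..<n}))) = card H * (d - m0) \<and>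
    (m0 = 0 \<longrightarrow> tight_frame G (ell G) (H \<times> {..<n}) (conv_system G f))"
proof -
  interpret convolution_setting G H
    by (intro convolution_setting.intro convolution_setting_axioms.intro assms)
  interpret frame_potential_minimizer G H n a f
    by (intro frame_potential_minimizer.intro frame_potential_minimizer_axioms.intro assms)
      (rule convolution_setting_axioms)
  have le: "card (rcosets\<^bsub>G\<^esub> H) \<le> n"
    using assms(4,5) by simp
  have m0: "m0 = card dominant"
    unfolding assms(8) assms(4) by (rule threshold_index[OF le assms(6)])
  have dom: "{..<m0} = dominant"
    unfolding m0 by (rule dominant_initial_segment[OF le assms(6), symmetric])
  have rest: "{m0..<n} = {..<n} - dominant"
    unfolding dom[symmetric] by auto
  have split: "H \<times> {..<n} = H \<times> dominant \<union> H \<times> ({..<n} - dominant)"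
    using dominant_less by auto
  have cross: "\<forall>p \<in> H \<times> dominant. \<forall>q \<in> H \<times> ({..<n} - dominant). ell_inner G (\<xi> p) (\<xi> q) = 0"
    using inner_dominant_rest(1) by auto
  have nz: "\<forall>p \<in> H \<times> dominant. \<xi> p \<noteq> 0"
    using xi_nonzero dominant_less by auto
  have orth: "\<forall>p \<in> H \<times> dominant. \<forall>q \<in> H \<times> dominant. p \<noteq> q \<longrightarrow> ell_inner G (\<xi> p) (\<xi> q) = 0"
    using dominant_orthogonal[OF le] by blast
  have whole: "m0 = 0 \<longrightarrow> tight_frame G (ell G) (H \<times> {..<n}) \<xi>"
    using tight_frame_ell[OF le] dom by auto
  have dim: "fun_space.dim (fun_space.span (\<xi> ` (H \<times> ({..<n} - dominant)))) = card H * (d - m0)"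
    using dim_span_rest[OF le] assms(4) m0 by simp
  show ?thesis
    unfolding dom rest
    by (intro conjI split cross tight_frame_rest[OF le] dim whole) (use nz orth in blast)
qed

end
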